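(* Let $(x_k)_{k\ge 0}$ be generated by the exact high-order proximal-point segment search algorithm described in the context (with regularization parameter $H>0$ and integer $p\ge 1$), with the associated quantities $A_k$, $g_k$ and $\Psi_k$. Put $\Psi_k^*=\min_{x\in\operatorname{dom}\psi}\Psi_k(x)$, let $x^*$ be a minimizer of $F$, let $R_0=\|x_0-x^*\|$, and set $$B_k=\tfrac12\left(\tfrac1H\right)^{1/p}\sum_{i=0}^{k-1}A_{i+1}\,g_i^{(p+1)/p}.$$ Then, for every $k\ge 1$: $$\Psi_k(x)\le A_kF(x)+\tfrac12\|x-x_0\|^2\quad\text{for all }x\in\operatorname{dom}\psi,$$ $$A_kF(x_k)+B_k\le \Psi_k^*,$$ and $$F(x_k)-F(x^* )\le 2^p\,H\,R_0^{p+1}\left(1+\tfrac{2(k-1)}{p+1}\right)^{-(3p+1)/2}.$$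
   Context: Setting. $\mathbb E$ is a finite-dimensional real vector space with dual $\mathbb E^*$; $\langle s,x\rangle$ is the value of $s\in\mathbb E^*$ at $x\in\mathbb E$. $B:\mathbb E\to\mathbb E^*$ is self-adjoint positive definite, $\|x\|=\langle Bx,x\rangle^{1/2}$ for $x\in\mathbb E$ and $\|g\|_*=\langle g,B^{-1}g\rangle^{1/2}$ for $g\in\mathbb E^*$. $p\ge1$ is an integer and $d_{p+1}(x)=\frac1{p+1}\|x\|^{p+1}$. The function $f:\mathbb E\to\mathbb R$ is convex and differentiable; $\psi:\mathbb E\to\mathbb R\cup\{+\infty\}$ is a proper closed convex function that is subdifferentiable at every point of $\operatorname{dom}\psi$; $F=f+\psi$ has at least one minimizer $x^*\in\operatorname{dom}\psi$. For $y\in\mathbb E$ write $\ell_y(x)=f(y)+\langle\nabla f(y),x-y\rangle$. Algorithm. Input $x_0\in\operatorname{dom}\psi$, $H>0$. Set $\upsilon_0=x_0$, $A_0=0$, $\Psi_0(x)=\frac12\|x-x_0\|^2$. For $k=0,1,2,\dots$: (1) $u_k=\upsilon_k-x_k$. (2) Let $(x_{k+1},\tau_k)$ be an exact solution of $\min_{x\in\operatorname{dom}\psi,\ \tau\in[0,1]}\{f(x)+\psi(x)+H\,d_{p+1}(x-x_k-\tau u_k)\}$. (3) Let $\gamma_k=-\nabla f(x_{k+1})-H\|x_{k+1}-(x_k+\tau_ku_k)\|^{p-1}B\big(x_{k+1}-(x_k+\tau_ku_k)\big)$, which belongs to $\partial\psi(x_{k+1})$ by optimality, and $g_k=\|\nabla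 f(x_{k+1})+\gamma_k\|_*$. (4) Let $a_{k+1}>0$ solve $\dfrac{a_{k+1}^2}{A_k+a_{k+1}}=\left(\tfrac1H\right)^{1/p}g_k^{(1-p)/p}$ and set $A_{k+1}=A_k+a_{k+1}$. (When $p\ge2$ this step requires $g_k>0$; the algorithm is run only as long as all steps are well defined.) (5) $\Psi_{k+1}(x)=\Psi_k(x)+a_{k+1}[\ell_{x_{k+1}}(x)+\psi(x)]$ and $\upsilon_{k+1}=\operatorname{argmin}_{x\in\operatorname{dom}\psi}\Psi_{k+1}(x)$. *)

theory Defs
  imports "HOL-Analysis.Analysis"
begin

text \<open>
  The space is a finite-dimensional \<open>'a :: real_normed_vector\<close>. The norm of the type class only
  supplies the (unique) topology; lengths are measured by \<open>B_norm B\<close>. As every linear functional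
  and every linear operator is bounded in finite dimension, the dual space is \<open>'a \<Rightarrow>\<^sub>L real\<close> and
  a linear operator from the space to its dual is an element of \<open>'a \<Rightarrow>\<^sub>L 'a \<Rightarrow>\<^sub>L real\<close>.
\<close>

definition self_adjoint_pos_def :: "('a::real_normed_vector \<Rightarrow>\<^sub>L 'a \<Rightarrow>\<^sub>L real) \<Rightarrow> bool" where
  "self_adjoint_pos_def B \<longleftrightarrow>
     (\<forall>x y. blinfun_apply (blinfun_apply B x) y = blinfun_apply (blinfun_apply B y) x) \<and>
     (\<forall>x. x \<noteq> 0 \<longrightarrow> blinfun_apply (blinfun_apply B x) x > 0)"

definition B_norm :: "('a::real_normed_vector \<Rightarrow>\<^sub>L 'a \<Rightarrow>\<^sub>L real) \<Rightarrow> 'a \<Rightarrow> real" where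
  "B_norm B x = sqrt (blinfun_apply (blinfun_apply B x) x)"

text \<open>A positive definite \<open>B\<close> is a bijection onto the dual in finite dimension, so \<open>inv\<close> below is
  its genuine inverse.\<close>

definition B_dual_norm :: "('a::real_normed_vector \<Rightarrow>\<^sub>L 'a \<Rightarrow>\<^sub>L real) \<Rightarrow> ('a \<Rightarrow>\<^sub>L real) \<Rightarrow> real" where
  "B_dual_norm B g = sqrt (blinfun_apply g (inv (blinfun_apply B) g))"

definition power_prox ::
  "('a::real_normed_vector \<Rightarrow>\<^sub>L 'a \<Rightarrow>\<^sub>L real) \<Rightarrow> nat \<Rightarrow> 'a \<Rightarrow> real" where
  "power_prox B q x = B_norm B x ^ q / real q"

definition gradient :: "('a::real_normed_vector \<Rightarrow> real) \<Rightarrow> 'a \<Rightarrow> ('a \<Rightarrow>\<^sub>L real)" where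
  "gradient f y = Blinfun (frechet_derivative f (at y))"

definition linearization :: "('a::real_normed_vector \<Rightarrow> real) \<Rightarrow> 'a \<Rightarrow> 'a \<Rightarrow> real" where
  "linearization f y x = f y + blinfun_apply (gradient f y) (x - y)"

definition eff_dom :: "('a \<Rightarrow> ereal) \<Rightarrow> 'a set" where
  "eff_dom \<psi> = {x. \<psi> x < \<infinity>}"

definition epi :: "('a \<Rightarrow> ereal) \<Rightarrow> ('a \<times> real) set" where
  "epi \<psi> = {(x, t). \<psi> x \<le> ereal t}"

definition proper_closed_convex :: "('a::real_normed_vector \<Rightarrow> ereal) \<Rightarrow> bool" where
  "proper_closed_convex \<psi> \<longleftrightarrow>
     (\<forall>x. \<psi> x \<noteq> -\<infinity>) \<and> eff_dom \<psi> \<noteq> {} \<and> closed (epi \<psi>) \<and> convex (epi \<psi>)"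

definition subdifferential :: "('a::real_normed_vector \<Rightarrow> ereal) \<Rightarrow> 'a \<Rightarrow> ('a \<Rightarrow>\<^sub>L real) set" where
  "subdifferential \<psi> x = {s. \<forall>y. \<psi> x + ereal (blinfun_apply s (y - x)) \<le> \<psi> y}"

definition composite :: "('a \<Rightarrow> real) \<Rightarrow> ('a \<Rightarrow> ereal) \<Rightarrow> 'a \<Rightarrow> ereal" where
  "composite f \<psi> x = ereal (f x) + \<psi> x"

text \<open>
  The iterates are kept in sequences: \<open>x k\<close>, \<open>\<upsilon> k\<close>, \<open>\<tau> k\<close>, \<open>A k\<close> for \<open>k \<ge> 0\<close> and
  \<open>a k\<close> for \<open>k \<ge> 1\<close> (the value \<open>a 0\<close> is never used).
\<close>

definition direction :: "(nat \<Rightarrow> 'a::real_normed_vector) \<Rightarrow> (nat \<Rightarrow> 'a) \<Rightarrow> nat \<Rightarrow> 'a" where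
  "direction x \<upsilon> k = \<upsilon> k - x k"

definition segment_residual ::
  "(nat \<Rightarrow> 'a::real_normed_vector) \<Rightarrow> (nat \<Rightarrow> 'a) \<Rightarrow> (nat \<Rightarrow> real) \<Rightarrow> nat \<Rightarrow> 'a" where
  "segment_residual x \<upsilon> \<tau> k = x (Suc k) - (x k + \<tau> k *\<^sub>R direction x \<upsilon> k)"

definition psi_subgrad ::
  "('a::real_normed_vector \<Rightarrow>\<^sub>L 'a \<Rightarrow>\<^sub>L real) \<Rightarrow> nat \<Rightarrow> real \<Rightarrow> ('a \<Rightarrow> real) \<Rightarrow>
   (nat \<Rightarrow> 'a) \<Rightarrow> (nat \<Rightarrow> 'a) \<Rightarrow> (nat \<Rightarrow> real) \<Rightarrow> nat \<Rightarrow> ('a \<Rightarrow>\<^sub>L real)" where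
  "psi_subgrad B p H f x \<upsilon> \<tau> k =
     - gradient f (x (Suc k))
     - (H * B_norm B (segment_residual x \<upsilon> \<tau> k) ^ (p - 1)) *\<^sub>R
         blinfun_apply B (segment_residual x \<upsilon> \<tau> k)"

definition grad_size ::
  "('a::real_normed_vector \<Rightarrow>\<^sub>L 'a \<Rightarrow>\<^sub>L real) \<Rightarrow> nat \<Rightarrow> real \<Rightarrow> ('a \<Rightarrow> real) \<Rightarrow>
   (nat \<Rightarrow> 'a) \<Rightarrow> (nat \<Rightarrow> 'a) \<Rightarrow> (nat \<Rightarrow> real) \<Rightarrow> nat \<Rightarrow> real" where
  "grad_size B p H f x \<upsilon> \<tau> k =
     B_dual_norm B (gradient f (x (Suc k)) + psi_subgrad B p H f x \<upsilon> \<tau> k)"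

fun estimating ::
  "('a::real_normed_vector \<Rightarrow>\<^sub>L 'a \<Rightarrow>\<^sub>L real) \<Rightarrow> ('a \<Rightarrow> real) \<Rightarrow> ('a \<Rightarrow> ereal) \<Rightarrow>
   (nat \<Rightarrow> 'a) \<Rightarrow> (nat \<Rightarrow> real) \<Rightarrow> nat \<Rightarrow> 'a \<Rightarrow> ereal" where
  "estimating B f \<psi> x a 0 y = ereal (1 / 2 * (B_norm B (y - x 0))\<^sup>2)"
| "estimating B f \<psi> x a (Suc k) y =
     estimating B f \<psi> x a k y
     + ereal (a (Suc k)) * (ereal (linearization f (x (Suc k)) y) + \<psi> y)"

definition estimating_min ::
  "('a::real_normed_vector \<Rightarrow>\<^sub>L 'a \<Rightarrow>\<^sub>L real) \<Rightarrow> ('a \<Rightarrow> real) \<Rightarrow> ('a \<Rightarrow> ereal) \<Rightarrow>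
   (nat \<Rightarrow> 'a) \<Rightarrow> (nat \<Rightarrow> real) \<Rightarrow> nat \<Rightarrow> ereal" where
  "estimating_min B f \<psi> x a k = (INF y\<in>eff_dom \<psi>. estimating B f \<psi> x a k y)"

text \<open>
  One iteration. For \<open>p = 1\<close> the factor with exponent \<open>(1 - p) / p = 0\<close> is \<open>1\<close> also when the
  gradient size vanishes, whereas \<open>0 powr 0 = 0\<close>; this is the reason for the case distinction.
\<close>

definition segment_search_step ::
  "('a::real_normed_vector \<Rightarrow>\<^sub>L 'a \<Rightarrow>\<^sub>L real) \<Rightarrow> nat \<Rightarrow> real \<Rightarrow> ('a \<Rightarrow> real) \<Rightarrow> ('a \<Rightarrow> ereal) \<Rightarrow>
   (nat \<Rightarrow> 'a) \<Rightarrow> (nat \<Rightarrow> 'a) \<Rightarrow> (nat \<Rightarrow> real) \<Rightarrow> (nat \<Rightarrow> real) \<Rightarrow> (nat \<Rightarrow> real) \<Rightarrow> nat \<Rightarrow> bool" where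
  "segment_search_step B p H f \<psi> x \<upsilon> \<tau> a A k \<longleftrightarrow>
     is_arg_min
       (\<lambda>(y, t). ereal (f y) + \<psi> y
                 + ereal (H * power_prox B (p + 1) (y - x k - t *\<^sub>R direction x \<upsilon> k)))
       (\<lambda>(y, t). y \<in> eff_dom \<psi> \<and> t \<in> {0..1})
       (x (Suc k), \<tau> k) \<and>
     (p \<ge> 2 \<longrightarrow> grad_size B p H f x \<upsilon> \<tau> k > 0) \<and>
     a (Suc k) > 0 \<and>
     (a (Suc k))\<^sup>2 / (A k + a (Suc k)) =
       (1 / H) powr (1 / real p) *
       (if p = 1 then 1 else grad_size B p H f x \<upsilon> \<tau> k powr ((1 - real p) / real p)) \<and>
     A (Suc k) = A k + a (Suc k) \<and>
     is_arg_min (estimating B f \<psi> x a (Suc k)) (\<lambda>y. y \<in> eff_dom \<psi>) (\<upsilon> (Suc k))"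

text \<open>
  The number \<open>N\<close> of completed iterations is finite or infinite, since the method stops at the
  first iteration that is not well defined.
\<close>

definition segment_search_run ::
  "('a::real_normed_vector \<Rightarrow>\<^sub>L 'a \<Rightarrow>\<^sub>L real) \<Rightarrow> nat \<Rightarrow> real \<Rightarrow> ('a \<Rightarrow> real) \<Rightarrow> ('a \<Rightarrow> ereal) \<Rightarrow>
   'a \<Rightarrow> enat \<Rightarrow>
   (nat \<Rightarrow> 'a) \<Rightarrow> (nat \<Rightarrow> 'a) \<Rightarrow> (nat \<Rightarrow> real) \<Rightarrow> (nat \<Rightarrow> real) \<Rightarrow> (nat \<Rightarrow> real) \<Rightarrow> bool" where
  "segment_search_run B p H f \<psi> x0 N x \<upsilon> \<tau> a A \<longleftrightarrow>
     x0 \<in> eff_dom \<psi> \<and> x 0 = x0 \<and> \<upsilon> 0 = x0 \<and> A 0 = 0 \<and>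
     (\<forall>k. enat k < N \<longrightarrow> segment_search_step B p H f \<psi> x \<upsilon> \<tau> a A k)"

definition B_sum ::
  "('a::real_normed_vector \<Rightarrow>\<^sub>L 'a \<Rightarrow>\<^sub>L real) \<Rightarrow> nat \<Rightarrow> real \<Rightarrow> ('a \<Rightarrow> real) \<Rightarrow>
   (nat \<Rightarrow> 'a) \<Rightarrow> (nat \<Rightarrow> 'a) \<Rightarrow> (nat \<Rightarrow> real) \<Rightarrow> (nat \<Rightarrow> real) \<Rightarrow> nat \<Rightarrow> real" where
  "B_sum B p H f x \<upsilon> \<tau> A k =
     1 / 2 * (1 / H) powr (1 / real p) *
     (\<Sum>i<k. A (Suc i) * grad_size B p H f x \<upsilon> \<tau> i powr ((real p + 1) / real p))"

end

theory Submission
  imports Defs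
begin

text \<open>
  The proof is an estimating-sequence argument followed by a growth estimate for the weights \<open>A\<^sub>k\<close>.

  The upper bound on \<open>\<Psi>\<^sub>k\<close> holds because linearizations of a convex function lie below it. For the lower
  bound, \<open>\<Psi>\<^sub>k\<close> exceeds its minimum by at least \<open>\<parallel>x - \<upsilon>\<^sub>k\<parallel>\<^sup>2 / 2\<close>, and \<open>s = \<nabla>f(x\<^bsub>k+1\<^esub>) + \<gamma>\<^sub>k\<close> is a subgradient of
  \<open>F\<close> at \<open>x\<^bsub>k+1\<^esub>\<close>. Hence the passage from \<open>\<Psi>\<^sub>k\<close> to \<open>\<Psi>\<^bsub>k+1\<^esub>\<close> is controlled by
  \<open>\<langle>s, A\<^sub>k x\<^sub>k + a\<^bsub>k+1\<^esub> x - A\<^bsub>k+1\<^esub> x\<^bsub>k+1\<^esub>\<rangle> + \<parallel>x - \<upsilon>\<^sub>k\<parallel>\<^sup>2 / 2\<close>. The segment search makes the component of this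
  vector along \<open>\<upsilon>\<^sub>k - x\<^sub>k\<close> harmless, since \<open>\<tau>\<^sub>k\<close> is optimal against the competitor \<open>a\<^bsub>k+1\<^esub> / A\<^bsub>k+1\<^esub>\<close>. The proximal
  step contributes the energy \<open>A\<^bsub>k+1\<^esub> H r\<^bsup>p+1\<^esup>\<close>, \<open>r\<close> being the length of the residual, and the choice of
  \<open>a\<^bsub>k+1\<^esub>\<close> lets the quadratic term consume exactly half of it. The other half is \<open>B\<^bsub>k+1\<^esub> - B\<^sub>k\<close>
  (\<open>step_gain\<close>, \<open>estimating_sequence_step\<close>).

  At \<open>x\<^sup>*\<close> the two bounds give \<open>A\<^sub>k (F(x\<^sub>k) - F(x\<^sup>*)) + B\<^sub>k \<le> R\<^sub>0\<^sup>2 / 2\<close>, which has two uses. It reduces the rate to a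
  lower bound on \<open>A\<^sub>k\<close>, and it bounds \<open>B\<^sub>k\<close>, so that the \<open>g\<^sub>i\<close> obey a budget weighted by \<open>A\<^bsub>i+1\<^esub>\<close>. For \<open>p > 1\<close>
  small \<open>g\<^sub>i\<close> in turn force fast growth: \<open>sqrt A\<^bsub>i+1\<^esub> - sqrt A\<^sub>i\<close> is at least a multiple of \<open>g\<^sub>i powr ((1 - p) / (2 p))\<close>.
  Hoelder's inequality eliminates the \<open>g\<^sub>i\<close> and leaves an implicit recursion for sums of powers of \<open>A\<^sub>i\<close>;
  solving it gives the exponent \<open>(3 p + 1) / 2\<close> (\<open>growth_under_budget\<close>, \<open>weight_lower_bound\<close>).
\<close>

section \<open>First-order conditions\<close>

text \<open>
  Every optimality condition below comes from this lemma. Along a segment issuing from a minimizer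
  the nonsmooth convex term is replaced by its chord, which is affine and only makes the function
  larger; what remains is differentiable at the starting point.
\<close>
lemma one_sided_minimum_derivative_nonneg:
  fixes \<phi> :: "real \<Rightarrow> real"
  assumes deriv: "(\<phi> has_real_derivative D) (at 0)"
    and min: "\<And>t. 0 < t \<Longrightarrow> t \<le> 1 \<Longrightarrow> \<phi> 0 \<le> \<phi> t"
  shows "0 \<le> D"
proof (rule ccontr)
  assume "\<not> 0 \<le> D"
  then obtain d where d: "d > 0" "\<And>h. h > 0 \<Longrightarrow> h < d \<Longrightarrow> \<phi> (0 + h) < \<phi> 0"
    using DERIV_neg_dec_right[OF deriv] by auto
  have "\<phi> (0 + min (d / 2) 1) < \<phi> 0" by (rule d(2)) (use d(1) in auto)
  then show False using min[of "min (d / 2) 1"] d(1) by auto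
qed

abbreviation B_inner ::
  "('a::real_normed_vector \<Rightarrow>\<^sub>L 'a \<Rightarrow>\<^sub>L real) \<Rightarrow> 'a \<Rightarrow> 'a \<Rightarrow> real" where
  "B_inner B u v \<equiv> blinfun_apply (blinfun_apply B u) v"

lemma B_inner_commute:
  "self_adjoint_pos_def B \<Longrightarrow> B_inner B u v = B_inner B v u"
  by (simp add: self_adjoint_pos_def_def)

lemma B_inner_self_nonneg: "self_adjoint_pos_def B \<Longrightarrow> 0 \<le> B_inner B w w"
  by (cases "w = 0") (auto simp: self_adjoint_pos_def_def less_imp_le)

lemma B_norm_nonneg: "self_adjoint_pos_def B \<Longrightarrow> 0 \<le> B_norm B w"
  by (simp add: B_norm_def B_inner_self_nonneg)

lemma B_norm_power2: "self_adjoint_pos_def B \<Longrightarrow> (B_norm B w)\<^sup>2 = B_inner B w w"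
  by (simp add: B_norm_def B_inner_self_nonneg)

lemmas blinfun_linear_simps =
  blinfun.add_left blinfun.add_right blinfun.diff_left blinfun.diff_right
  blinfun.scaleR_left blinfun.scaleR_right blinfun.minus_left blinfun.minus_right

lemma B_norm_power2_add_scaleR:
  assumes "self_adjoint_pos_def B"
  shows "(B_norm B (w + t *\<^sub>R h))\<^sup>2
      = (B_norm B w)\<^sup>2 + 2 * t * B_inner B w h + t\<^sup>2 * (B_norm B h)\<^sup>2"
  using B_inner_commute[OF assms, of h w]
  unfolding B_norm_power2[OF assms]
  by (simp add: blinfun_linear_simps power2_eq_square algebra_simps)

lemma B_norm_minus: "B_norm B (- w) = B_norm B w"
  by (simp add: B_norm_def blinfun_linear_simps)

text \<open>
  On the range of \<open>B\<close> injectivity alone identifies \<open>inv B (B w)\<close> with \<open>w\<close>. The dual norm is only ever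
  taken of multiples of \<open>B w\<close>.
\<close>
lemma B_dual_norm_scaleR_apply:
  assumes B: "self_adjoint_pos_def B"
  shows "B_dual_norm B (c *\<^sub>R blinfun_apply B w) = \<bar>c\<bar> * B_norm B w"
proof -
  have "inj (blinfun_apply B)"
  proof (rule injI, rule ccontr)
    fix u v assume eq: "blinfun_apply B u = blinfun_apply B v" and "u \<noteq> v"
    then have "B_inner B (u - v) (u - v) > 0" using B by (simp add: self_adjoint_pos_def_def)
    then show False using eq by (simp add: blinfun_linear_simps)
  qed
  then have "inv (blinfun_apply B) (c *\<^sub>R blinfun_apply B w) = c *\<^sub>R w"
    by (metis blinfun.scaleR_right inv_f_f)
  then show ?thesis
    by (simp add: B_dual_norm_def B_norm_def blinfun_linear_simps real_sqrt_mult mult.assoc[symmetric])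
qed

text \<open>
  Off the origin this is the chain rule for the square root of a positive quadratic polynomial. At
  the origin the function is a multiple of \<open>\<bar>t\<bar> ^ (p + 1)\<close>, whose derivative vanishes because
  \<open>p + 1 > 1\<close>.
\<close>
lemma power_prox_along_line:
  assumes B: "self_adjoint_pos_def B" and p: "p \<ge> 1"
  shows "((\<lambda>t. power_prox B (p + 1) (w + t *\<^sub>R h)) has_real_derivative
           B_norm B w ^ (p - 1) * B_inner B w h) (at 0)"
proof (cases "w = 0")
  case True
  have "((\<lambda>t::real. B_norm B h ^ (p + 1) * \<bar>t\<bar> ^ p) \<longlongrightarrow> B_norm B h ^ (p + 1) * \<bar>0\<bar> ^ p) (at 0)"
    by (intro tendsto_intros)
  then have lim: "((\<lambda>t::real. B_norm B h ^ (p + 1) * \<bar>t\<bar> ^ p) \<longlongrightarrow> 0) (at 0)"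
    using p by (simp add: zero_power)
  have bound: "norm (power_prox B (p + 1) (t *\<^sub>R h) / t) \<le> B_norm B h ^ (p + 1) * \<bar>t\<bar> ^ p" for t
  proof (cases "t = 0")
    case False
    have "B_norm B (t *\<^sub>R h) = \<bar>t\<bar> * B_norm B h"
      by (simp add: B_norm_def blinfun_linear_simps real_sqrt_mult mult.assoc[symmetric])
    then have "power_prox B (p + 1) (t *\<^sub>R h)
        = \<bar>t\<bar> * (B_norm B h ^ (p + 1) * \<bar>t\<bar> ^ p / real (p + 1))"
      by (simp add: power_prox_def power_mult_distrib)
    then have "norm (power_prox B (p + 1) (t *\<^sub>R h) / t)
        = B_norm B h ^ (p + 1) * \<bar>t\<bar> ^ p / real (p + 1)"
      using False B_norm_nonneg[OF B, of h] by (simp add: abs_mult)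
    also have "\<dots> \<le> B_norm B h ^ (p + 1) * \<bar>t\<bar> ^ p / 1"
      using B_norm_nonneg[OF B, of h] by (intro divide_left_mono) auto
    finally show ?thesis by simp
  qed (use B_norm_nonneg[OF B, of h] p in simp)
  have "((\<lambda>t. power_prox B (p + 1) (t *\<^sub>R h) / t) \<longlongrightarrow> 0) (at 0)"
    using bound by (intro Lim_null_comparison[OF always_eventually lim] allI)
  then show ?thesis
    using True p by (simp add: DERIV_def power_prox_def B_norm_def)
next
  case False
  define Q where "Q t = (B_norm B w)\<^sup>2 + 2 * t * B_inner B w h + t\<^sup>2 * (B_norm B h)\<^sup>2" for t
  have w: "B_norm B w > 0"
    using False B by (simp add: B_norm_def self_adjoint_pos_def_def)
  have "((\<lambda>t. sqrt (Q t)) has_real_derivative B_inner B w h / B_norm B w) (at 0)"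
    unfolding Q_def using w by (auto intro!: derivative_eq_intros simp: field_simps)
  from DERIV_cdivide[OF DERIV_power[OF this, of "p + 1"], of "real (p + 1)"]
  have "((\<lambda>t. sqrt (Q t) ^ (p + 1) / real (p + 1)) has_real_derivative
      B_inner B w h / B_norm B w * B_norm B w ^ p) (at 0)"
    using w by (simp add: Q_def del: of_nat_add of_nat_Suc)
  also have "B_inner B w h / B_norm B w * B_norm B w ^ p = B_norm B w ^ (p - 1) * B_inner B w h"
    using w p by (cases p) auto
  also have "(\<lambda>t. sqrt (Q t) ^ (p + 1) / real (p + 1)) = (\<lambda>t. power_prox B (p + 1) (w + t *\<^sub>R h))"
    using B_norm_nonneg[OF B]
    by (simp add: Q_def power_prox_def fun_eq_iff flip: B_norm_power2_add_scaleR[OF B])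
  finally show ?thesis .
qed

lemma gradient_along_line:
  assumes "f differentiable (at y)"
  shows "((\<lambda>t. f (y + t *\<^sub>R h)) has_real_derivative blinfun_apply (gradient f y) h) (at 0)"
proof -
  have D: "(f has_derivative frechet_derivative f (at y)) (at y)"
    using assms by (simp add: frechet_derivative_works)
  then have "blinfun_apply (gradient f y) = frechet_derivative f (at y)"
    unfolding gradient_def by (intro bounded_linear_Blinfun_apply has_derivative_bounded_linear)
  with D have D': "(f has_derivative blinfun_apply (gradient f y)) (at (y + 0 *\<^sub>R h))" by simp
  have "((\<lambda>t. y + t *\<^sub>R h) has_derivative (\<lambda>t. t *\<^sub>R h)) (at 0)"
    by (auto intro!: derivative_eq_intros)
  from has_derivative_compose[OF this D'] show ?thesis
    by (simp add: has_field_derivative_def blinfun.scaleR_right mult_commute_abs)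
qed

lemma linearization_le_convex:
  assumes f: "convex_on UNIV f" and diff: "f differentiable (at y)"
  shows "linearization f y z \<le> f z"
proof -
  define \<phi> where "\<phi> t = (1 - t) * f y + t * f z - f (y + t *\<^sub>R (z - y))" for t
  have "(\<phi> has_real_derivative (f z - f y - blinfun_apply (gradient f y) (z - y))) (at 0)"
    unfolding \<phi>_def
    by (rule derivative_eq_intros gradient_along_line[OF diff] refl)+ simp
  moreover have "\<phi> 0 \<le> \<phi> t" if "0 < t" "t \<le> 1" for t
  proof -
    have "y + t *\<^sub>R (z - y) = (1 - t) *\<^sub>R y + t *\<^sub>R z" by (simp add: algebra_simps)
    then show ?thesis
      using convex_onD[OF f, of t y z] that by (simp add: \<phi>_def)
  qed
  ultimately have "0 \<le> f z - f y - blinfun_apply (gradient f y) (z - y)"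
    by (rule one_sided_minimum_derivative_nonneg)
  then show ?thesis by (simp add: linearization_def)
qed

text \<open>
  Strong convexity at a minimizer. Adding a convex function to \<open>\<parallel>\<cdot> - c\<parallel>\<^sup>2 / 2\<close> keeps the quadratic term exactly: the first-order part of
  the sum is nonnegative at the minimizer, and the second-order part is \<open>\<parallel>z - m\<parallel>\<^sup>2 / 2\<close>.
\<close>
lemma quadratic_growth_at_minimizer:
  assumes B: "self_adjoint_pos_def B" and h: "convex_on Q h" and m: "m \<in> Q" and z: "z \<in> Q"
    and min: "\<And>y. y \<in> Q \<Longrightarrow>
      1 / 2 * (B_norm B (m - c))\<^sup>2 + h m \<le> 1 / 2 * (B_norm B (y - c))\<^sup>2 + h y"
  shows "1 / 2 * (B_norm B (m - c))\<^sup>2 + h m + 1 / 2 * (B_norm B (z - m))\<^sup>2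
      \<le> 1 / 2 * (B_norm B (z - c))\<^sup>2 + h z"
proof -
  define b N where "b = B_inner B (m - c) (z - m)" and "N = (B_norm B (z - m))\<^sup>2"
  have sq: "(B_norm B (m + t *\<^sub>R (z - m) - c))\<^sup>2 = (B_norm B (m - c))\<^sup>2 + 2 * t * b + t\<^sup>2 * N" for t
    using B_norm_power2_add_scaleR[OF B, of "m - c" t "z - m"]
    by (simp add: b_def N_def algebra_simps)
  define \<phi> where "\<phi> t = t * b + t\<^sup>2 * N / 2 + t * (h z - h m)" for t
  have "(\<phi> has_real_derivative (b + (h z - h m))) (at 0)"
    unfolding \<phi>_def by (auto intro!: derivative_eq_intros)
  moreover have "\<phi> 0 \<le> \<phi> t" if t: "0 < t" "t \<le> 1" for t
  proof -
    have eq: "m + t *\<^sub>R (z - m) = (1 - t) *\<^sub>R m + t *\<^sub>R z" by (simp add: algebra_simps)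
    have "m + t *\<^sub>R (z - m) \<in> Q"
      unfolding eq using convex_on_imp_convex[OF h] m z t by (intro convexD) auto
    moreover have "h (m + t *\<^sub>R (z - m)) \<le> (1 - t) * h m + t * h z"
      unfolding eq using convex_onD[OF h] m z t by simp
    ultimately show ?thesis
      using min[of "m + t *\<^sub>R (z - m)"]
      by (simp add: sq \<phi>_def left_diff_distrib right_diff_distrib add_divide_distrib)
  qed
  ultimately have "0 \<le> b + (h z - h m)"
    by (rule one_sided_minimum_derivative_nonneg)
  then show ?thesis using sq[of 1] by (simp add: N_def add_divide_distrib)
qed

text \<open>
  This is the membership \<open>\<gamma>\<^sub>k \<in> \<partial>\<psi>(x\<^bsub>k+1\<^esub>)\<close>: with the search parameter held at its optimal value, the
  new iterate is a proximal point for the centre \<open>c\<close>.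
\<close>
lemma prox_minimizer_subgradient:
  assumes B: "self_adjoint_pos_def B" and p: "p \<ge> 1"
    and diff: "f differentiable (at z)" and h: "convex_on Q h" and z: "z \<in> Q" and y: "y \<in> Q"
    and min: "\<And>y. y \<in> Q \<Longrightarrow>
      f z + h z + H * power_prox B (p + 1) (z - c) \<le> f y + h y + H * power_prox B (p + 1) (y - c)"
  shows "h z + blinfun_apply
      (- gradient f z - (H * B_norm B (z - c) ^ (p - 1)) *\<^sub>R blinfun_apply B (z - c)) (y - z) \<le> h y"
proof -
  define \<phi> where "\<phi> t = f (z + t *\<^sub>R (y - z)) + t * (h y - h z)
      + H * power_prox B (p + 1) (z - c + t *\<^sub>R (y - z))" for t
  have "(\<phi> has_real_derivative blinfun_apply (gradient f z) (y - z) + (h y - h z)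
      + H * (B_norm B (z - c) ^ (p - 1) * B_inner B (z - c) (y - z))) (at 0)"
    unfolding \<phi>_def
    by (rule derivative_eq_intros gradient_along_line[OF diff] power_prox_along_line[OF B p] refl)+ simp
  moreover have "\<phi> 0 \<le> \<phi> t" if t: "0 < t" "t \<le> 1" for t
  proof -
    have eq: "z + t *\<^sub>R (y - z) = (1 - t) *\<^sub>R z + t *\<^sub>R y" by (simp add: algebra_simps)
    have "z + t *\<^sub>R (y - z) \<in> Q"
      unfolding eq using convex_on_imp_convex[OF h] z y t by (intro convexD) auto
    moreover have "h (z + t *\<^sub>R (y - z)) \<le> (1 - t) * h z + t * h y"
      unfolding eq using convex_onD[OF h] z y t by simp
    ultimately show ?thesis
      using min[of "z + t *\<^sub>R (y - z)"] by (simp add: \<phi>_def algebra_simps)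
  qed
  ultimately have "0 \<le> blinfun_apply (gradient f z) (y - z) + (h y - h z)
      + H * (B_norm B (z - c) ^ (p - 1) * B_inner B (z - c) (y - z))"
    by (rule one_sided_minimum_derivative_nonneg)
  then show ?thesis
    by (simp add: blinfun.diff_left blinfun.minus_left blinfun.scaleR_left mult.assoc)
qed

text \<open>
  Optimality in the search parameter with the point fixed. The inequality is later used at
  \<open>s = a\<^bsub>k+1\<^esub> / A\<^bsub>k+1\<^esub>\<close>; the search over the whole segment replaces the problem of guessing this value in
  advance, when \<open>a\<^bsub>k+1\<^esub>\<close> is not yet known.
\<close>
lemma segment_minimizer_variational:
  assumes B: "self_adjoint_pos_def B" and p: "p \<ge> 1"
    and \<tau>: "\<tau> \<in> {0..1}" and s: "s \<in> {0..1}"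
    and min: "\<And>t. t \<in> {0..1} \<Longrightarrow>
      power_prox B (p + 1) (v - \<tau> *\<^sub>R u) \<le> power_prox B (p + 1) (v - t *\<^sub>R u)"
  shows "(s - \<tau>) * (B_norm B (v - \<tau> *\<^sub>R u) ^ (p - 1) * B_inner B (v - \<tau> *\<^sub>R u) u) \<le> 0"
proof -
  define w h where "w = v - \<tau> *\<^sub>R u" and "h = (\<tau> - s) *\<^sub>R u"
  have "((\<lambda>t. power_prox B (p + 1) (w + t *\<^sub>R h)) has_real_derivative
      B_norm B w ^ (p - 1) * B_inner B w h) (at 0)"
    by (rule power_prox_along_line[OF B p])
  moreover have "power_prox B (p + 1) (w + 0 *\<^sub>R h) \<le> power_prox B (p + 1) (w + t *\<^sub>R h)"
    if t: "0 < t" "t \<le> 1" for t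
  proof -
    have "(1 - t) *\<^sub>R \<tau> + t *\<^sub>R s \<in> {0..1}"
      using \<tau> s t by (intro convexD convex_closed_interval) auto
    then have "\<tau> + t * (s - \<tau>) \<in> {0..1}" by (simp add: algebra_simps)
    from min[OF this] show ?thesis by (simp add: w_def h_def algebra_simps)
  qed
  ultimately have "0 \<le> B_norm B w ^ (p - 1) * B_inner B w h"
    by (rule one_sided_minimum_derivative_nonneg)
  then show ?thesis by (simp add: w_def h_def blinfun_linear_simps algebra_simps)
qed

section \<open>Gain of one iteration\<close>

text \<open>
  For \<open>g = H r\<^sup>p\<close> both sides are \<open>g\<close> times \<open>(g / H)\<^bsup>1/p\<^esup> = r\<close>. The identity converts the energy
  \<open>H r\<^bsup>p+1\<^esup>\<close> of a proximal step into the summand of \<open>B\<^sub>k\<close>.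
\<close>
lemma gradient_size_energy:
  fixes H r :: real and p :: nat
  assumes p: "p \<ge> 1" and H: "H > 0" and r: "r \<ge> 0"
  shows "(1 / H) powr (1 / real p) * (H * r ^ p) powr ((real p + 1) / real p) = H * r ^ (p + 1)"
proof (cases "r = 0")
  case False
  with r have r: "r > 0" by simp
  have "(r ^ p) powr ((real p + 1) / real p) = r powr real (p + 1)"
    using r p by (simp add: powr_powr add.commute flip: powr_realpow)
  then have "(1 / H) powr (1 / real p) * (H * r ^ p) powr ((real p + 1) / real p)
      = (1 / H) powr (1 / real p) * H powr ((real p + 1) / real p) * r powr real (p + 1)"
    using r H by (simp add: powr_mult mult.assoc)
  also have "(1 / H) powr (1 / real p) * H powr ((real p + 1) / real p) = H"
    using H p by (simp add: powr_divide add_divide_distrib powr_add)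
  also have "r powr real (p + 1) = r ^ (p + 1)" using r by (rule powr_realpow)
  finally show ?thesis .
qed (use p in auto)

text \<open>
  With \<open>s = - H \<parallel>w\<parallel>\<^bsup>p-1\<^esup> B w\<close>, the right-hand side is \<open>\<langle>s, A x + a z - (A + a) x'\<rangle> + \<parallel>z - \<upsilon>\<parallel>\<^sup>2 / 2\<close>, which
  will bound the excess of \<open>\<Psi>\<^bsub>k+1\<^esub>(z)\<close> over \<open>A\<^bsub>k+1\<^esub> F(x\<^bsub>k+1\<^esub>) + B\<^sub>k\<close> from below. The vector splits as
  \<open>a (z - \<upsilon>) + (a - (A + a) \<tau>) u - (A + a) w\<close> with \<open>u = \<upsilon> - x\<close>. Its last part yields the energy
  \<open>(A + a) H r\<^bsup>p+1\<^esup>\<close> with \<open>r = \<parallel>w\<parallel>\<close>; the middle part is nonnegative by optimality of \<open>\<tau>\<close>; the first part,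
  absorbed by the quadratic, costs at most \<open>a\<^sup>2 g\<^sup>2 / 2\<close>. The equation for \<open>a\<close> is chosen to make this
  cost exactly half of the energy.
\<close>
lemma step_gain:
  fixes H A a \<tau> :: real and p :: nat and x x' \<upsilon> z :: "'a::real_normed_vector"
  assumes B: "self_adjoint_pos_def B" and p: "p \<ge> 1" and H: "H > 0" and A: "A \<ge> 0" and a: "a > 0"
  defines "w \<equiv> x' - (x + \<tau> *\<^sub>R (\<upsilon> - x))"
  defines "g \<equiv> H * B_norm B w ^ p"
  assumes \<tau>: "\<And>t. t \<in> {0..1} \<Longrightarrow>
      (t - \<tau>) * (B_norm B w ^ (p - 1) * B_inner B w (\<upsilon> - x)) \<le> 0"
    and g: "p \<ge> 2 \<Longrightarrow> g > 0"
    and a_eq: "a\<^sup>2 / (A + a) =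
      (1 / H) powr (1 / real p) * (if p = 1 then 1 else g powr ((1 - real p) / real p))"
  shows "1 / 2 * (1 / H) powr (1 / real p) * ((A + a) * g powr ((real p + 1) / real p))
      \<le> - (H * B_norm B w ^ (p - 1)) * B_inner B w (A *\<^sub>R x + a *\<^sub>R z - (A + a) *\<^sub>R x')
        + 1 / 2 * (B_norm B (z - \<upsilon>))\<^sup>2"
proof -
  define r \<eta> E where "r = B_norm B w" and "\<eta> = H * r ^ (p - 1)" and "E = H * r ^ (p + 1)"
  have r: "r \<ge> 0" by (simp add: r_def B_norm_nonneg[OF B])
  have \<eta>r: "\<eta> * r = g" and \<eta>r2: "\<eta> * r\<^sup>2 = E"
    using p by (cases p; simp add: \<eta>_def g_def E_def r_def power2_eq_square)+
  have E: "(1 / H) powr (1 / real p) * g powr ((real p + 1) / real p) = E"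
    using gradient_size_energy[OF p H r] by (simp add: g_def r_def E_def)
  have "(1 / H) powr (1 / real p) * (if p = 1 then 1 else g powr ((1 - real p) / real p)) * g\<^sup>2 = E"
  proof (cases "p = 1")
    case True
    then show ?thesis using H r by (simp add: E_def g_def r_def power2_eq_square)
  next
    case False
    with p g have "g > 0" by simp
    have "(1 - real p) / real p + 2 = (real p + 1) / real p"
      using p by (simp add: field_simps)
    then have "g powr ((1 - real p) / real p) * g powr 2 = g powr ((real p + 1) / real p)"
      by (metis powr_add)
    then show ?thesis using False E \<open>g > 0\<close> by (simp add: mult.assoc)
  qed
  then have ag: "a\<^sup>2 * g\<^sup>2 = (A + a) * E"
    using a_eq A a by (simp add: field_simps)
  have split: "A *\<^sub>R x + a *\<^sub>R z - (A + a) *\<^sub>R x'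
      = a *\<^sub>R (z - \<upsilon>) + (a - (A + a) * \<tau>) *\<^sub>R (\<upsilon> - x) - (A + a) *\<^sub>R w"
    by (simp add: w_def algebra_simps)
  have seg: "\<eta> * ((a - (A + a) * \<tau>) * B_inner B w (\<upsilon> - x)) \<le> 0"
  proof -
    have "\<eta> * ((a - (A + a) * \<tau>) * B_inner B w (\<upsilon> - x))
        = H * (A + a) * ((a / (A + a) - \<tau>) * (r ^ (p - 1) * B_inner B w (\<upsilon> - x)))"
      using A a by (simp add: \<eta>_def field_simps)
    also have "\<dots> \<le> 0"
    proof (rule mult_nonneg_nonpos)
      show "0 \<le> H * (A + a)" using A a H by simp
      show "(a / (A + a) - \<tau>) * (r ^ (p - 1) * B_inner B w (\<upsilon> - x)) \<le> 0"
        unfolding r_def using A a by (intro \<tau>) auto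
    qed
    finally show ?thesis .
  qed
  (* The minimum over z of the linear term plus the quadratic, by completing the square. *)
  have "0 \<le> (B_norm B ((z - \<upsilon>) + (- \<eta> * a) *\<^sub>R w))\<^sup>2" by simp
  also have "\<dots> = (B_norm B (z - \<upsilon>))\<^sup>2 - 2 * \<eta> * a * B_inner B w (z - \<upsilon>) + a\<^sup>2 * g\<^sup>2"
    unfolding B_norm_power2_add_scaleR[OF B]
    using B_inner_commute[OF B, of "z - \<upsilon>" w] by (simp add: r_def power_mult_distrib flip: \<eta>r)
  finally have sq: "\<eta> * (a * B_inner B w (z - \<upsilon>))
      \<le> 1 / 2 * (B_norm B (z - \<upsilon>))\<^sup>2 + 1 / 2 * ((A + a) * E)"
    by (simp add: ag)
  have "\<eta> * B_inner B w (A *\<^sub>R x + a *\<^sub>R z - (A + a) *\<^sub>R x')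
      = \<eta> * (a * B_inner B w (z - \<upsilon>)) + \<eta> * ((a - (A + a) * \<tau>) * B_inner B w (\<upsilon> - x))
        - (A + a) * E"
    unfolding split \<eta>r2[symmetric] r_def B_norm_power2[OF B]
    by (simp add: blinfun_linear_simps algebra_simps)
  with seg sq have "1 / 2 * ((A + a) * E)
      \<le> - \<eta> * B_inner B w (A *\<^sub>R x + a *\<^sub>R z - (A + a) *\<^sub>R x') + 1 / 2 * (B_norm B (z - \<upsilon>))\<^sup>2"
    unfolding minus_mult_left[symmetric] by linarith
  moreover have "1 / 2 * (1 / H) powr (1 / real p) * ((A + a) * g powr ((real p + 1) / real p))
      = 1 / 2 * ((A + a) * E)"
    unfolding E[symmetric] by simp
  ultimately show ?thesis by (simp only: \<eta>_def r_def)
qed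

section \<open>Extended-valued convex functions on their domain\<close>

lemma eff_dom_real:
  assumes "proper_closed_convex \<psi>" "y \<in> eff_dom \<psi>"
  shows "\<psi> y = ereal (real_of_ereal (\<psi> y))"
  using assms by (cases "\<psi> y") (auto simp: proper_closed_convex_def eff_dom_def)

lemma convex_on_eff_dom:
  assumes psi: "proper_closed_convex \<psi>"
  shows "convex_on (eff_dom \<psi>) (\<lambda>y. real_of_ereal (\<psi> y))"
proof -
  have epi: "convex (epi \<psi>)" using psi by (simp add: proper_closed_convex_def)
  have le: "\<psi> (u *\<^sub>R y + v *\<^sub>R z) \<le> ereal (u * real_of_ereal (\<psi> y) + v * real_of_ereal (\<psi> z))"
    if "y \<in> eff_dom \<psi>" "z \<in> eff_dom \<psi>" "0 \<le> u" "0 \<le> v" "u + v = 1" for y z u v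
  proof -
    have "(y, real_of_ereal (\<psi> y)) \<in> epi \<psi>" "(z, real_of_ereal (\<psi> z)) \<in> epi \<psi>"
      using eff_dom_real[OF psi] that by (auto simp: epi_def)
    from convexD[OF epi this that(3-5)] show ?thesis by (simp add: epi_def)
  qed
  have dom: "u *\<^sub>R y + v *\<^sub>R z \<in> eff_dom \<psi>"
    if "y \<in> eff_dom \<psi>" "z \<in> eff_dom \<psi>" "0 \<le> u" "0 \<le> v" "u + v = 1" for y z u v
    using le[OF that] by (auto simp: eff_dom_def intro: le_less_trans)
  show ?thesis
    unfolding convex_on_def
  proof (intro conjI ballI allI impI)
    show "convex (eff_dom \<psi>)" using dom by (auto simp: convex_def)
  next
    fix y z and u v :: real
    assume *: "y \<in> eff_dom \<psi>" "z \<in> eff_dom \<psi>" "0 \<le> u" "0 \<le> v" "u + v = 1"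
    show "real_of_ereal (\<psi> (u *\<^sub>R y + v *\<^sub>R z)) \<le> u * real_of_ereal (\<psi> y) + v * real_of_ereal (\<psi> z)"
      using le[OF *] eff_dom_real[OF psi dom[OF *]] by (metis ereal_less_eq(3))
  qed
qed

section \<open>Growth of sequences under a weighted budget\<close>

text \<open>
  Hoelder's inequality in its homogeneous form: Young's inequality, applied to the summands
  divided by the two total sums.
\<close>
lemma sum_powr_Holder:
  fixes u v :: "'i \<Rightarrow> real"
  assumes I: "finite I" "I \<noteq> {}"
    and pos: "\<And>i. i \<in> I \<Longrightarrow> u i > 0" "\<And>i. i \<in> I \<Longrightarrow> v i > 0"
    and exps: "0 \<le> \<alpha>" "0 \<le> \<beta>" "\<alpha> + \<beta> = 1"
  shows "(\<Sum>i\<in>I. u i powr \<alpha> * v i powr \<beta>) \<le> sum u I powr \<alpha> * sum v I powr \<beta>"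
proof -
  define U V where "U = sum u I" and "V = sum v I"
  have U: "U > 0" and V: "V > 0"
    unfolding U_def V_def using I pos by (auto intro!: sum_pos)
  have term_le: "u i powr \<alpha> * v i powr \<beta>
      \<le> (U powr \<alpha> * V powr \<beta>) * (\<alpha> * (u i / U) + \<beta> * (v i / V))" if "i \<in> I" for i
  proof -
    have "u i powr \<alpha> * v i powr \<beta>
        = (U powr \<alpha> * V powr \<beta>) * ((u i / U) powr \<alpha> * (v i / V) powr \<beta>)"
      using U V pos[OF that] by (simp add: powr_divide)
    also have "\<dots> \<le> (U powr \<alpha> * V powr \<beta>) * (\<alpha> * (u i / U) + \<beta> * (v i / V))"
      using U V pos[OF that] exps by (intro mult_left_mono Youngs_inequality_0) auto
    finally show ?thesis .
  qed
  have "(\<Sum>i\<in>I. u i powr \<alpha> * v i powr \<beta>)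
      \<le> (\<Sum>i\<in>I. (U powr \<alpha> * V powr \<beta>) * (\<alpha> * (u i / U) + \<beta> * (v i / V)))"
    by (intro sum_mono term_le)
  also have "\<dots> = (U powr \<alpha> * V powr \<beta>) * (\<alpha> * (U / U) + \<beta> * (V / V))"
    by (simp only: U_def V_def sum_distrib_left[symmetric] sum.distrib sum_divide_distrib[symmetric])
  also have "\<dots> = U powr \<alpha> * V powr \<beta>"
    using U V exps by simp
  finally show ?thesis by (simp add: U_def V_def)
qed

text \<open>
  Concavity of \<open>t powr e\<close>, with the tangent taken at \<open>X\<close>. Evaluating the slope at the larger of two
  consecutive partial sums is what an implicit recursion requires.
\<close>
lemma powr_below_tangent:
  fixes X Y e :: real
  assumes "0 < X" "0 < Y" "0 \<le> e" "e \<le> 1"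
  shows "e * X powr (e - 1) * (X - Y) \<le> X powr e - Y powr e"
proof -
  have "Y powr e = X powr (e - 1) * (Y powr e * X powr (1 - e))"
    using assms by (simp add: powr_add[symmetric] mult.left_commute)
  also have "\<dots> \<le> X powr (e - 1) * (e * Y + (1 - e) * X)"
    using assms by (intro mult_left_mono Youngs_inequality_0) auto
  also have "\<dots> = X powr (e - 1) * X - e * X powr (e - 1) * (X - Y)"
    by (simp add: algebra_simps)
  also have "X powr (e - 1) * X = X powr e"
    using assms by (simp add: powr_diff)
  finally show ?thesis by simp
qed

text \<open>
  A discrete Bihari argument. The sums \<open>T\<^sub>j\<close> of \<open>S\<^sub>i powr q\<close> have increments
  \<open>T\<^sub>j - T\<^bsub>j-1\<^esub> = S\<^sub>j powr q \<ge> c powr q * T\<^sub>j powr (2 * \<theta>)\<close>, a discrete form of \<open>T' \<ge> c powr q * T powr (2 * \<theta>)\<close>.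
  As \<open>2 * \<theta> < 1\<close>, the power \<open>T powr (1 - 2 * \<theta>)\<close> grows linearly, and the hypothesis turns this into
  a bound for \<open>S\<close>.
\<close>
lemma self_improving_growth:
  fixes S :: "nat \<Rightarrow> real" and \<theta> c :: real
  defines "q \<equiv> 2 * \<theta> / (1 + \<theta>)"
  assumes c: "c > 0" and \<theta>: "0 \<le> \<theta>" "2 * \<theta> < 1" and k: "k \<ge> 1"
    and pos: "\<And>j. 1 \<le> j \<Longrightarrow> j \<le> k \<Longrightarrow> S j > 0"
    and S: "\<And>j. 1 \<le> j \<Longrightarrow> j \<le> k \<Longrightarrow> c * (\<Sum>i<j. S (Suc i) powr q) powr (1 + \<theta>) \<le> S j"
  shows "(c * (1 + (1 - 2 * \<theta>) * (real k - 1)) powr (1 + \<theta>)) powr (1 / (1 - 2 * \<theta>)) \<le> S k"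
proof -
  define e where "e = 1 - 2 * \<theta>"
  define T where "T j = (\<Sum>i<j. S (Suc i) powr q)" for j
  have e: "0 < e" "e \<le> 1" using \<theta> by (auto simp: e_def)
  have q0: "0 \<le> q" and q1: "q * (1 + \<theta>) = 2 * \<theta>" using \<theta> by (auto simp: q_def)
  have T_pos: "T j > 0" if "1 \<le> j" "j \<le> k" for j
  proof -
    have "S (Suc i) > 0" if "i < j" for i
      using pos[of "Suc i"] that \<open>j \<le> k\<close> by simp
    then show ?thesis
      unfolding T_def using that by (intro sum_pos) (fastforce simp: lessThan_empty_iff)+
  qed
  have incr: "c powr q * T j powr (2 * \<theta>) \<le> S j powr q" if "1 \<le> j" "j \<le> k" for j
  proof -
    have "c powr q * T j powr (2 * \<theta>) = (c * T j powr (1 + \<theta>)) powr q"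
      using c T_pos[OF that] by (simp add: powr_mult powr_powr mult.commute[of _ q] q1)
    also have "\<dots> \<le> S j powr q"
      using S[OF that] c q0 by (intro powr_mono2) (auto simp: T_def)
    finally show ?thesis .
  qed
  have T_growth: "c powr q * (1 + e * real j) \<le> T (Suc j) powr e" if "Suc j \<le> k" for j
    using that
  proof (induction j)
    case 0
    have "c powr q * T 1 powr (2 * \<theta>) \<le> T 1"
      using incr[of 1] 0 by (simp add: T_def)
    then have "c powr q \<le> T 1 / T 1 powr (2 * \<theta>)"
      using T_pos[of 1] 0 by (simp add: field_simps)
    also have "\<dots> = T 1 powr e"
      using T_pos[of 1] 0 by (simp add: e_def powr_diff)
    finally show ?case by simp
  next
    case (Suc j)
    define X Y where "X = T (Suc (Suc j))" and "Y = T (Suc j)"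
    have X: "X > 0" and Y: "Y > 0" using T_pos Suc.prems by (auto simp: X_def Y_def)
    have XY: "X - Y = S (Suc (Suc j)) powr q" by (simp add: X_def Y_def T_def)
    have "e * c powr q = e * X powr (e - 1) * (c powr q * X powr (2 * \<theta>))"
      using X by (simp add: e_def powr_minus field_simps)
    also have "\<dots> \<le> e * X powr (e - 1) * (X - Y)"
      unfolding XY using incr[of "Suc (Suc j)"] Suc.prems e
      by (intro mult_left_mono) (auto simp: X_def)
    also have "\<dots> \<le> X powr e - Y powr e"
      using X Y e by (intro powr_below_tangent) auto
    finally show ?case
      using Suc.IH Suc.prems by (simp add: X_def Y_def algebra_simps)
  qed
  define M where "M = 1 + e * (real k - 1)"
  have M: "M > 0" using e k by (auto simp: M_def intro!: add_pos_nonneg)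
  have Tk: "T k > 0" using T_pos k by simp
  have "c powr q * M \<le> T k powr e"
    using T_growth[of "k - 1"] k by (simp add: M_def of_nat_diff)
  then have "(c powr q * M) powr ((1 + \<theta>) / e) \<le> (T k powr e) powr ((1 + \<theta>) / e)"
    using M c e \<theta> by (intro powr_mono2) auto
  also have "\<dots> = T k powr (1 + \<theta>)"
    using e Tk by (simp add: powr_powr)
  finally have "c * (c powr q * M) powr ((1 + \<theta>) / e) \<le> c * T k powr (1 + \<theta>)"
    using c by simp
  also have "\<dots> \<le> S k"
    using S[of k] k by (simp add: T_def)
  also have "c * (c powr q * M) powr ((1 + \<theta>) / e) = (c * M powr (1 + \<theta>)) powr (1 / e)"
  proof -
    have "1 + 2 * \<theta> / e = 1 / e" using e by (simp add: e_def field_simps)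
    then have "c powr (1 / e) = c powr 1 * c powr (2 * \<theta> / e)"
      using c by (metis powr_add)
    then show ?thesis
      using c M q1 by (simp add: powr_mult powr_powr)
  qed
  finally show ?thesis by (simp add: M_def e_def)
qed

text \<open>
  Each step raises \<open>S\<close> by a negative power of \<open>\<xi>\<close>, and the budget limits the \<open>\<xi>\<^sub>i\<close> with weights \<open>S\<^sup>2\<close>. The
  exponents \<open>\<alpha> = \<theta> / (1 + \<theta>)\<close> and \<open>\<beta> = 1 / (1 + \<theta>)\<close> are those for which \<open>\<xi>\<close> cancels from
  \<open>(S\<^sup>2 \<xi>) powr \<alpha> * (\<xi> powr - \<theta>) powr \<beta>\<close>. Hoelder's inequality with them bounds the sum of the
  remaining powers of \<open>S\<close> by \<open>D\<close> and \<open>S\<close> itself, which is the self-improving hypothesis above.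
\<close>
lemma growth_under_budget:
  fixes S \<xi> :: "nat \<Rightarrow> real" and c \<theta> D :: real
  assumes c: "c > 0" and \<theta>: "0 \<le> \<theta>" "2 * \<theta> < 1" and k: "k \<ge> 1" and S0: "S 0 = 0"
    and \<xi>: "\<And>i. i < k \<Longrightarrow> \<xi> i > 0"
    and step: "\<And>i. i < k \<Longrightarrow> c * \<xi> i powr - \<theta> \<le> S (Suc i) - S i"
    and budget: "(\<Sum>i<k. (S (Suc i))\<^sup>2 * \<xi> i) \<le> D"
  shows "(c * D powr - \<theta> * (1 + (1 - 2 * \<theta>) * (real k - 1)) powr (1 + \<theta>)) powr (1 / (1 - 2 * \<theta>))
      \<le> S k"
proof (rule self_improving_growth)
  define \<alpha> \<beta> where "\<alpha> = \<theta> / (1 + \<theta>)" and "\<beta> = 1 / (1 + \<theta>)"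
  have exps: "0 \<le> \<alpha>" "0 \<le> \<beta>" "\<alpha> + \<beta> = 1" "\<alpha> * (1 + \<theta>) = \<theta>" "\<beta> * (1 + \<theta>) = 1"
      "\<alpha> = \<theta> * \<beta>" "2 * \<alpha> = 2 * \<theta> / (1 + \<theta>)"
    using \<theta> by (auto simp: \<alpha>_def \<beta>_def add_divide_distrib[symmetric])
  have S_pos: "S (Suc i) > 0" if "i < k" for i
    using that
  proof (induction i)
    case 0
    have "0 < c * \<xi> 0 powr - \<theta>" using c \<xi>[of 0] 0 by simp
    then show ?case using step[of 0] 0 S0 by linarith
  next
    case (Suc i)
    have "0 < c * \<xi> (Suc i) powr - \<theta>" using c \<xi>[of "Suc i"] Suc.prems by simp
    then show ?case using step[of "Suc i"] Suc by fastforce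
  qed
  show "S j > 0" if "1 \<le> j" "j \<le> k" for j
    using S_pos[of "j - 1"] that by simp
  have summand_pos: "(S (Suc i))\<^sup>2 * \<xi> i > 0" if "i < k" for i
    using S_pos[OF that] \<xi>[OF that] by simp
  have "(S 1)\<^sup>2 * \<xi> 0 \<le> D"
    using budget member_le_sum[of 0 "{..<k}" "\<lambda>i. (S (Suc i))\<^sup>2 * \<xi> i"] summand_pos k
    by (force simp: less_imp_le)
  with summand_pos[of 0] k have D: "D > 0" by simp
  then show "c * D powr - \<theta> > 0" using c by simp
  show "c * D powr - \<theta> * (\<Sum>i<j. S (Suc i) powr (2 * \<theta> / (1 + \<theta>))) powr (1 + \<theta>) \<le> S j"
    if j: "1 \<le> j" "j \<le> k" for j
  proof -
    define Z where "Z = (\<Sum>i<j. \<xi> i powr - \<theta>)"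
    have \<xi>_pos: "\<xi> i powr - \<theta> > 0" if "i < j" for i using \<xi>[of i] that j by simp
    have Z: "Z > 0"
      unfolding Z_def using j \<xi>_pos by (intro sum_pos) (auto simp: lessThan_empty_iff)
    have "c * Z \<le> (\<Sum>i<j. S (Suc i) - S i)"
      unfolding Z_def sum_distrib_left using j step by (intro sum_mono) auto
    then have Z_le: "c * Z \<le> S j" by (simp add: sum_lessThan_telescope S0)
    have sub_budget: "(\<Sum>i<j. (S (Suc i))\<^sup>2 * \<xi> i) \<le> D"
      using budget j summand_pos
      by (intro order_trans[OF sum_mono2 budget]) (auto intro!: less_imp_le)
    have "(\<Sum>i<j. S (Suc i) powr (2 * \<theta> / (1 + \<theta>)))
        = (\<Sum>i<j. ((S (Suc i))\<^sup>2 * \<xi> i) powr \<alpha> * (\<xi> i powr - \<theta>) powr \<beta>)"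
    proof (rule sum.cong[OF refl])
      fix i assume "i \<in> {..<j}"
      with j have i: "S (Suc i) > 0" "\<xi> i > 0" using S_pos \<xi> by auto
      have "((S (Suc i))\<^sup>2) powr \<alpha> = S (Suc i) powr (2 * \<alpha>)"
        using i by (simp add: powr_powr flip: powr_numeral)
      moreover have cancel: "\<xi> i powr \<alpha> * (\<xi> i powr - \<theta>) powr \<beta> = 1"
        using i exps(6) by (simp add: powr_powr flip: powr_add)
      ultimately show "S (Suc i) powr (2 * \<theta> / (1 + \<theta>))
          = ((S (Suc i))\<^sup>2 * \<xi> i) powr \<alpha> * (\<xi> i powr - \<theta>) powr \<beta>"
        using i exps(7) cancel by (simp add: powr_mult mult.assoc)
    qed
    also have "\<dots> \<le> (\<Sum>i<j. (S (Suc i))\<^sup>2 * \<xi> i) powr \<alpha> * Z powr \<beta>"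
      unfolding Z_def using j exps(1-3) summand_pos \<xi>_pos
      by (intro sum_powr_Holder) (auto simp: lessThan_empty_iff)
    also have "\<dots> \<le> D powr \<alpha> * Z powr \<beta>"
      using sub_budget exps(1) j summand_pos
      by (intro mult_right_mono powr_mono2 sum_nonneg) (auto intro!: less_imp_le)
    finally have "(\<Sum>i<j. S (Suc i) powr (2 * \<theta> / (1 + \<theta>))) powr (1 + \<theta>)
        \<le> (D powr \<alpha> * Z powr \<beta>) powr (1 + \<theta>)"
      using \<theta> by (intro powr_mono2) (auto intro!: sum_nonneg)
    also have "\<dots> = D powr \<theta> * Z"
      using D Z exps(4,5) by (simp add: powr_mult powr_powr)
    finally have "c * D powr - \<theta> * (\<Sum>i<j. S (Suc i) powr (2 * \<theta> / (1 + \<theta>))) powr (1 + \<theta>)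
        \<le> c * D powr - \<theta> * (D powr \<theta> * Z)"
      using c by (intro mult_left_mono) auto
    also have "\<dots> = c * Z" using D by (simp add: powr_minus)
    finally show ?thesis using Z_le by linarith
  qed
qed (use \<theta> k in auto)

section \<open>Lower bound for the accumulated weights\<close>

lemma sqrt_increment:
  fixes A a :: real
  assumes "A \<ge> 0" "a > 0"
  shows "1 / 2 * sqrt (a\<^sup>2 / (A + a)) \<le> sqrt (A + a) - sqrt A"
proof -
  have "a = (sqrt (A + a) - sqrt A) * (sqrt (A + a) + sqrt A)"
    using assms by (simp add: algebra_simps flip: power2_eq_square)
  also have "\<dots> \<le> (sqrt (A + a) - sqrt A) * (2 * sqrt (A + a))"
    using assms by (intro mult_left_mono) auto
  finally have "a \<le> (sqrt (A + a) - sqrt A) * (2 * sqrt (A + a))" .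
  then show ?thesis
    using assms by (simp add: real_sqrt_divide field_simps)
qed

text \<open>
  The growth lemma applies to \<open>S = sqrt A\<close> and \<open>\<xi> = g powr ((p + 1) / p)\<close> with
  \<open>\<theta> = (p - 1) / (2 (p + 1))\<close>: the equation for \<open>a\<close> bounds the increments of \<open>S\<close> from below by a multiple
  of \<open>\<xi> powr - \<theta>\<close>. The exponents are then \<open>1 - 2 \<theta> = 2 / (p + 1)\<close> and
  \<open>1 + \<theta> = (3 p + 1) / (2 (p + 1))\<close>, whence the power \<open>(3 p + 1) / 2\<close> in the rate.
  The claim avoids division by \<open>R\<close>, so that \<open>R = 0\<close> is trivial.
\<close>
lemma weight_lower_bound:
  fixes A a g :: "nat \<Rightarrow> real" and p k :: nat and H R :: real
  assumes p: "p \<ge> 1" and H: "H > 0" and R: "R \<ge> 0" and k: "k \<ge> 1" and A0: "A 0 = 0"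
    and a: "\<And>i. i < k \<Longrightarrow> a (Suc i) > 0"
    and A: "\<And>i. i < k \<Longrightarrow> A (Suc i) = A i + a (Suc i)"
    and a_eq: "\<And>i. i < k \<Longrightarrow> (a (Suc i))\<^sup>2 / (A i + a (Suc i)) =
      (1 / H) powr (1 / real p) * (if p = 1 then 1 else g i powr ((1 - real p) / real p))"
    and g: "\<And>i. i < k \<Longrightarrow> p \<ge> 2 \<Longrightarrow> g i > 0"
    and budget: "(\<Sum>i<k. A (Suc i) * g i powr ((real p + 1) / real p)) \<le> H powr (1 / real p) * R\<^sup>2"
  shows "R\<^sup>2 \<le> 2 * A k * (2 ^ p * H * R ^ (p + 1)
      * (1 + 2 * (real k - 1) / (real p + 1)) powr (- (3 * real p + 1) / 2))"
proof -
  have A_nonneg: "A i \<ge> 0" if "i \<le> k" for i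
    using that
  proof (induction i)
    case (Suc i)
    then show ?case using A[of i] a[of i] by simp
  qed (simp add: A0)
  show ?thesis
  proof (cases "R = 0")
    case True
    then show ?thesis using A_nonneg[of k] H by simp
  next
    case False
    with R have R: "R > 0" by simp
    define c \<theta> where "c = 1 / 2 * (1 / H) powr (1 / (2 * real p))"
      and "\<theta> = (real p - 1) / (2 * (real p + 1))"
    (* For p = 1 the gradient sizes may vanish, but then \<theta> = 0 and the powers of \<xi> and D are 1;
       the constant sequence 1, with D as its weighted sum, meets the budget by definition. *)
    define \<xi> where "\<xi> i = (if p = 1 then 1 else g i powr ((real p + 1) / real p))" for i
    define D where "D = (if p = 1 then \<Sum>i<k. (sqrt (A (Suc i)))\<^sup>2 else H powr (1 / real p) * R\<^sup>2)"
    define M where "M = 1 + 2 * (real k - 1) / (real p + 1)"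
    have M: "M > 0" using k by (auto simp: M_def intro!: add_pos_nonneg)
    have c: "c > 0" using H by (simp add: c_def)
    have A_pos: "A (Suc i) > 0" if "i < k" for i
      using A[OF that] a[OF that] A_nonneg[of i] that by simp
    have exps: "1 - 2 * \<theta> = 2 / (real p + 1)" "1 + \<theta> = (3 * real p + 1) / (2 * (real p + 1))"
      by (simp_all add: \<theta>_def field_simps)
    have "(\<Sum>i<k. (sqrt (A (Suc i)))\<^sup>2) > 0"
      using A_pos k by (intro sum_pos) (auto simp: lessThan_empty_iff less_imp_neq[symmetric])
    then have D: "D > 0"
      using R H by (simp add: D_def)
    have "(c * D powr - \<theta> * (1 + (1 - 2 * \<theta>) * (real k - 1)) powr (1 + \<theta>)) powr (1 / (1 - 2 * \<theta>))
        \<le> sqrt (A k)"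
    proof (rule growth_under_budget[where \<xi> = \<xi>])
      show "0 < \<xi> i" if "i < k" for i using g[OF that] p by (auto simp: \<xi>_def)
      show "c * \<xi> i powr - \<theta> \<le> sqrt (A (Suc i)) - sqrt (A i)" if i: "i < k" for i
      proof -
        have "\<xi> i powr - \<theta> = sqrt (if p = 1 then 1 else g i powr ((1 - real p) / real p))"
        proof (cases "p = 1")
          case False
          with p g[OF i] have "g i > 0" by simp
          have "(real p + 1) / real p * - \<theta> = (1 - real p) / real p * (1 / 2)"
            by (simp add: \<theta>_def divide_simps) (simp add: algebra_simps)
          then show ?thesis
            using False \<open>g i > 0\<close> by (simp add: \<xi>_def powr_powr flip: powr_half_sqrt)
        qed (simp add: \<xi>_def)
        moreover have "sqrt ((1 / H) powr (1 / real p)) = (1 / H) powr (1 / (2 * real p))"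
          using H by (simp add: powr_powr mult.commute flip: powr_half_sqrt)
        ultimately have "c * \<xi> i powr - \<theta> = 1 / 2 * sqrt ((a (Suc i))\<^sup>2 / (A i + a (Suc i)))"
          unfolding a_eq[OF i] c_def by (simp add: real_sqrt_mult)
        also have "\<dots> \<le> sqrt (A i + a (Suc i)) - sqrt (A i)"
          using i a A_nonneg by (intro sqrt_increment) auto
        finally show ?thesis by (simp add: A[OF i])
      qed
      show "(\<Sum>i<k. (sqrt (A (Suc i)))\<^sup>2 * \<xi> i) \<le> D"
      proof (cases "p = 1")
        case False
        have "(\<Sum>i<k. (sqrt (A (Suc i)))\<^sup>2 * \<xi> i) = (\<Sum>i<k. A (Suc i) * g i powr ((real p + 1) / real p))"
          using False A_nonneg by (intro sum.cong) (auto simp: \<xi>_def)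
        then show ?thesis using budget False by (simp add: D_def)
      qed (simp add: D_def \<xi>_def)
    qed (use c k p A0 in \<open>auto simp: \<theta>_def divide_simps\<close>)
    then have "(c * D powr - \<theta> * M powr (1 + \<theta>)) powr ((real p + 1) / 2) \<le> sqrt (A k)"
      by (simp add: exps(1) M_def)
    then have "((c * D powr - \<theta> * M powr (1 + \<theta>)) powr ((real p + 1) / 2))\<^sup>2 \<le> (sqrt (A k))\<^sup>2"
      by (intro power_mono) auto
    also have "((c * D powr - \<theta> * M powr (1 + \<theta>)) powr ((real p + 1) / 2))\<^sup>2
        = (c * D powr - \<theta> * M powr (1 + \<theta>)) powr (real p + 1)"
      by (simp add: power2_eq_square flip: powr_add)
    also have "\<dots> = (c * D powr - \<theta>) powr (real p + 1) * M powr ((3 * real p + 1) / 2)"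
    proof -
      have cancel: "u / (2 * n) * n = u / 2" if "n > 0" for u n :: real using that by simp
      have "(1 + \<theta>) * (real p + 1) = (3 * real p + 1) / 2"
        unfolding exps(2) by (rule cancel) simp
      then show ?thesis
        using c D M by (simp add: powr_mult powr_powr del: eq_divide_eq_numeral1)
    qed
    also have "(c * D powr - \<theta>) powr (real p + 1) = R\<^sup>2 / (2 ^ (p + 1) * H * R ^ (p + 1))"
    proof (cases "p = 1")
      case True
      then have K: "c * D powr - \<theta> = 1 / 2 * (1 / H) powr (1 / 2)"
        using D by (simp add: \<theta>_def c_def)
      show ?thesis
        unfolding K using True R H by (simp add: powr_mult power2_eq_square flip: powr_add)
    next
      case False
      (* The constant is a product of powers of 2, H and R; logarithms make the identity linear. *)
      have "ln ((c * D powr - \<theta>) powr (real p + 1)) = (real p + 1) * (ln c - \<theta> * ln D)"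
        using c D by (simp add: ln_powr ln_mult)
      also have "ln c = - ln 2 - ln H / (2 * real p)"
        using H by (simp add: c_def ln_powr ln_mult ln_div)
      also have "ln D = ln H / real p + 2 * ln R"
        using H R False by (simp add: D_def ln_powr ln_mult ln_realpow)
      also have "(real p + 1) * (- ln 2 - ln H / (2 * real p) - \<theta> * (ln H / real p + 2 * ln R))
          = 2 * ln R - ((real p + 1) * ln 2 + ln H + (real p + 1) * ln R)"
        using p by (simp add: \<theta>_def divide_simps) (simp add: algebra_simps)
      also have "\<dots> = ln (R\<^sup>2 / (2 ^ (p + 1) * H * R ^ (p + 1)))"
        using H R by (simp add: ln_div ln_mult ln_realpow algebra_simps)
      finally show ?thesis
        using c D H R by (subst (asm) ln_inj_iff) auto
    qed
    also have "(sqrt (A k))\<^sup>2 = A k" using A_nonneg by simp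
    finally have "R\<^sup>2 / (2 ^ (p + 1) * H * R ^ (p + 1)) * M powr ((3 * real p + 1) / 2) \<le> A k" .
    then have "R\<^sup>2 \<le> A k * (2 ^ (p + 1) * H * R ^ (p + 1)) / M powr ((3 * real p + 1) / 2)"
      using H R M by (simp add: field_simps)
    also have "\<dots> = 2 * A k * (2 ^ p * H * R ^ (p + 1) * M powr (- (3 * real p + 1) / 2))"
      unfolding minus_divide_left[symmetric] using M by (simp add: powr_minus field_simps)
    finally show ?thesis by (simp add: M_def)
  qed
qed

section \<open>Estimating functions along a run\<close>

text \<open>
  The values of the estimating functions on the domain of \<open>\<psi>\<close> as real numbers, in closed form instead
  of by recursion, so that convexity and minimization can be treated over the reals.
\<close>
definition estimating_real ::
  "('a::real_normed_vector \<Rightarrow>\<^sub>L 'a \<Rightarrow>\<^sub>L real) \<Rightarrow> ('a \<Rightarrow> real) \<Rightarrow> ('a \<Rightarrow> ereal) \<Rightarrow>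
   (nat \<Rightarrow> 'a) \<Rightarrow> (nat \<Rightarrow> real) \<Rightarrow> nat \<Rightarrow> 'a \<Rightarrow> real" where
  "estimating_real B f \<psi> x a k y =
     1 / 2 * (B_norm B (y - x 0))\<^sup>2
     + (\<Sum>i<k. a (Suc i) * (linearization f (x (Suc i)) y + real_of_ereal (\<psi> y)))"

lemma estimating_eq_real:
  assumes psi: "proper_closed_convex \<psi>" and y: "y \<in> eff_dom \<psi>"
  shows "estimating B f \<psi> x a k y = ereal (estimating_real B f \<psi> x a k y)"
proof -
  obtain c where c: "\<psi> y = ereal c" using eff_dom_real[OF psi y] by blast
  show ?thesis by (induction k) (simp_all add: c estimating_real_def)
qed

lemma estimating_real_le:
  assumes f: "convex_on UNIV f" and diff: "\<forall>y. f differentiable (at y)"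
    and a: "\<And>i. i < k \<Longrightarrow> a (Suc i) \<ge> 0"
  shows "estimating_real B f \<psi> x a k y
    \<le> (\<Sum>i<k. a (Suc i)) * (f y + real_of_ereal (\<psi> y)) + 1 / 2 * (B_norm B (y - x 0))\<^sup>2"
proof -
  have "(\<Sum>i<k. a (Suc i) * (linearization f (x (Suc i)) y + real_of_ereal (\<psi> y)))
      \<le> (\<Sum>i<k. a (Suc i) * (f y + real_of_ereal (\<psi> y)))"
    using a diff linearization_le_convex[OF f] by (intro sum_mono mult_left_mono add_right_mono) auto
  then show ?thesis by (simp add: estimating_real_def sum_distrib_right)
qed

lemma estimating_real_quadratic_growth:
  assumes B: "self_adjoint_pos_def B" and psi: "proper_closed_convex \<psi>"
    and a: "\<And>i. i < k \<Longrightarrow> a (Suc i) \<ge> 0" and m: "m \<in> eff_dom \<psi>" and z: "z \<in> eff_dom \<psi>"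
    and min: "\<And>y. y \<in> eff_dom \<psi> \<Longrightarrow>
      estimating_real B f \<psi> x a k m \<le> estimating_real B f \<psi> x a k y"
  shows "estimating_real B f \<psi> x a k m + 1 / 2 * (B_norm B (z - m))\<^sup>2
      \<le> estimating_real B f \<psi> x a k z"
proof -
  have dom: "convex (eff_dom \<psi>)"
    using convex_on_eff_dom[OF psi] by (rule convex_on_imp_convex)
  have lin: "convex_on (eff_dom \<psi>) (linearization f v)" for v
    unfolding convex_on_def
  proof (intro conjI dom ballI allI impI)
    fix y z and s t :: real
    assume "s + t = 1"
    then have s: "s = 1 - t" by simp
    have "linearization f v (s *\<^sub>R y + t *\<^sub>R z) = s * linearization f v y + t * linearization f v z"
      by (simp add: s linearization_def blinfun_linear_simps algebra_simps)
    then show "linearization f v (s *\<^sub>R y + t *\<^sub>R z)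
        \<le> s * linearization f v y + t * linearization f v z" by simp
  qed
  have "convex_on (eff_dom \<psi>)
      (\<lambda>y. \<Sum>i<k. a (Suc i) * (linearization f (x (Suc i)) y + real_of_ereal (\<psi> y)))"
    using a
  proof (induction k)
    case 0
    show ?case using dom by (simp add: convex_on_const)
  next
    case (Suc k)
    have "convex_on (eff_dom \<psi>)
        (\<lambda>y. a (Suc k) * (linearization f (x (Suc k)) y + real_of_ereal (\<psi> y)))"
      using Suc.prems by (intro convex_on_cmul convex_on_add lin convex_on_eff_dom[OF psi]) simp
    with Suc.IH Suc.prems show ?case
      unfolding sum.lessThan_Suc by (intro convex_on_add) simp_all
  qed
  from quadratic_growth_at_minimizer[OF B this m z, where c = "x 0"] min
  show ?thesis by (simp add: estimating_real_def)
qed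

text \<open>
  Fixing either component of the joint minimizer makes the other one optimal; this translates the
  extended-real specification of an iteration into the real inequalities used from here on.
\<close>
lemma segment_search_step_consequences:
  assumes B: "self_adjoint_pos_def B" and p: "p \<ge> 1" and H: "H > 0"
    and diff: "\<forall>y. f differentiable (at y)" and psi: "proper_closed_convex \<psi>"
    and step: "segment_search_step B p H f \<psi> x \<upsilon> \<tau> a A k"
  defines "w \<equiv> segment_residual x \<upsilon> \<tau> k"
  shows "x (Suc k) \<in> eff_dom \<psi>"
    and "grad_size B p H f x \<upsilon> \<tau> k = H * B_norm B w ^ p"
    and "\<And>y. y \<in> eff_dom \<psi> \<Longrightarrow>
      real_of_ereal (\<psi> (x (Suc k))) + blinfun_apply (psi_subgrad B p H f x \<upsilon> \<tau> k) (y - x (Suc k))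
        \<le> real_of_ereal (\<psi> y)"
    and "\<And>t. t \<in> {0..1} \<Longrightarrow>
      (t - \<tau> k) * (B_norm B w ^ (p - 1) * B_inner B w (direction x \<upsilon> k)) \<le> 0"
    and "\<upsilon> (Suc k) \<in> eff_dom \<psi>"
    and "\<And>y. y \<in> eff_dom \<psi> \<Longrightarrow>
      estimating_real B f \<psi> x a (Suc k) (\<upsilon> (Suc k)) \<le> estimating_real B f \<psi> x a (Suc k) y"
proof -
  let ?u = "direction x \<upsilon> k" and ?z = "x (Suc k)"
  have argmin: "is_arg_min
      (\<lambda>(y, t). ereal (f y) + \<psi> y + ereal (H * power_prox B (p + 1) (y - x k - t *\<^sub>R ?u)))
      (\<lambda>(y, t). y \<in> eff_dom \<psi> \<and> t \<in> {0..1}) (?z, \<tau> k)"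
    and argmin': "is_arg_min (estimating B f \<psi> x a (Suc k)) (\<lambda>y. y \<in> eff_dom \<psi>) (\<upsilon> (Suc k))"
    using step by (auto simp: segment_search_step_def)
  show z: "?z \<in> eff_dom \<psi>" and \<upsilon>: "\<upsilon> (Suc k) \<in> eff_dom \<psi>"
    using argmin argmin' by (auto simp: is_arg_min_def)
  have \<tau>: "\<tau> k \<in> {0..1}" using argmin by (auto simp: is_arg_min_def)
  have min: "f ?z + real_of_ereal (\<psi> ?z) + H * power_prox B (p + 1) (?z - x k - \<tau> k *\<^sub>R ?u)
      \<le> f y + real_of_ereal (\<psi> y) + H * power_prox B (p + 1) (y - x k - t *\<^sub>R ?u)"
    if y: "y \<in> eff_dom \<psi>" and t: "t \<in> {0..1}" for y t
  proof -
    have "ereal (f ?z) + \<psi> ?z + ereal (H * power_prox B (p + 1) (?z - x k - \<tau> k *\<^sub>R ?u))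
        \<le> ereal (f y) + \<psi> y + ereal (H * power_prox B (p + 1) (y - x k - t *\<^sub>R ?u))"
      using argmin y t by (auto simp: is_arg_min_def not_less)
    then show ?thesis
      by (subst (asm) (1 2) eff_dom_real[OF psi]) (use y z in auto)
  qed
  have w: "w = ?z - (x k + \<tau> k *\<^sub>R ?u)" "w = ?z - x k - \<tau> k *\<^sub>R ?u"
    by (simp_all add: w_def segment_residual_def)
  have H_pow: "H * B_norm B w ^ (p - 1) * B_norm B w = H * B_norm B w ^ p"
    using p by (cases p) auto
  have "gradient f ?z + psi_subgrad B p H f x \<upsilon> \<tau> k
      = (- (H * B_norm B w ^ (p - 1))) *\<^sub>R blinfun_apply B w"
    by (simp add: psi_subgrad_def w_def)
  then show "grad_size B p H f x \<upsilon> \<tau> k = H * B_norm B w ^ p"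
    using H B_norm_nonneg[OF B, of w]
    by (simp add: grad_size_def B_dual_norm_scaleR_apply[OF B] H_pow[symmetric] abs_mult
        del: scaleR_minus_left)
  show "real_of_ereal (\<psi> ?z) + blinfun_apply (psi_subgrad B p H f x \<upsilon> \<tau> k) (y - ?z)
      \<le> real_of_ereal (\<psi> y)" if y: "y \<in> eff_dom \<psi>" for y
    unfolding psi_subgrad_def w_def[symmetric] w(1)
    by (rule prox_minimizer_subgradient[OF B p _ convex_on_eff_dom[OF psi] z y])
      (use diff min[OF _ \<tau>] in \<open>auto simp: diff_diff_eq\<close>)
  show "(t - \<tau> k) * (B_norm B w ^ (p - 1) * B_inner B w ?u) \<le> 0" if t: "t \<in> {0..1}" for t
    unfolding w(2)
    by (rule segment_minimizer_variational[OF B p \<tau> t]) (use min[OF z] H in auto)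
  show "estimating_real B f \<psi> x a (Suc k) (\<upsilon> (Suc k)) \<le> estimating_real B f \<psi> x a (Suc k) y"
    if y: "y \<in> eff_dom \<psi>" for y
  proof -
    have "estimating B f \<psi> x a (Suc k) (\<upsilon> (Suc k)) \<le> estimating B f \<psi> x a (Suc k) y"
      using argmin' y by (auto simp: is_arg_min_def not_less simp del: estimating.simps)
    then show ?thesis
      by (simp only: estimating_eq_real[OF psi y] estimating_eq_real[OF psi \<upsilon>] ereal_less_eq)
  qed
qed

text \<open>
  The induction step of \<open>A\<^sub>k F(x\<^sub>k) + B\<^sub>k \<le> \<Psi>\<^sub>k\<^sup>*\<close>. Let \<open>s = \<nabla>f(x\<^bsub>k+1\<^esub>) + \<gamma>\<^sub>k\<close>, a subgradient of \<open>F\<close> at \<open>x\<^bsub>k+1\<^esub>\<close>. Its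
  minorant bounds both \<open>F(x\<^sub>k)\<close>, with weight \<open>A\<^sub>k\<close>, and the newly added model at \<open>y\<close>, with weight \<open>a\<^bsub>k+1\<^esub>\<close>.
  Together with quadratic growth of \<open>\<Psi>\<^sub>k\<close> around \<open>\<upsilon>\<^sub>k\<close> only the terms of \<open>step_gain\<close> remain.
\<close>
lemma estimating_sequence_step:
  assumes B: "self_adjoint_pos_def B" and p: "p \<ge> 1" and H: "H > 0"
    and f: "convex_on UNIV f" and diff: "\<forall>y. f differentiable (at y)"
    and psi: "proper_closed_convex \<psi>"
    and step: "segment_search_step B p H f \<psi> x \<upsilon> \<tau> a A k"
    and A: "A k \<ge> 0" and a: "\<And>i. i < k \<Longrightarrow> a (Suc i) \<ge> 0"
    and x: "x k \<in> eff_dom \<psi>" and \<upsilon>: "\<upsilon> k \<in> eff_dom \<psi>" and y: "y \<in> eff_dom \<psi>"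
    and min: "\<And>y. y \<in> eff_dom \<psi> \<Longrightarrow>
      estimating_real B f \<psi> x a k (\<upsilon> k) \<le> estimating_real B f \<psi> x a k y"
    and IH: "A k * (f (x k) + real_of_ereal (\<psi> (x k))) + B_sum B p H f x \<upsilon> \<tau> A k
      \<le> estimating_real B f \<psi> x a k (\<upsilon> k)"
  shows "A (Suc k) * (f (x (Suc k)) + real_of_ereal (\<psi> (x (Suc k)))) + B_sum B p H f x \<upsilon> \<tau> A (Suc k)
      \<le> estimating_real B f \<psi> x a (Suc k) y"
proof -
  note cons = segment_search_step_consequences[OF B p H diff psi step]
  let ?z = "x (Suc k)" and ?a = "a (Suc k)" and ?g = "grad_size B p H f x \<upsilon> \<tau> k"
  define w where "w = segment_residual x \<upsilon> \<tau> k"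
  define F where "F v = f v + real_of_ereal (\<psi> v)" for v
  define s where "s = gradient f ?z + psi_subgrad B p H f x \<upsilon> \<tau> k"
  have s: "blinfun_apply s v = - (H * B_norm B w ^ (p - 1)) * B_inner B w v" for v
    by (simp add: s_def psi_subgrad_def w_def blinfun_linear_simps)
  have a_pos: "?a > 0" and A_Suc: "A (Suc k) = A k + ?a"
    and a_eq: "?a\<^sup>2 / (A k + ?a) = (1 / H) powr (1 / real p) *
       (if p = 1 then 1 else ?g powr ((1 - real p) / real p))"
    and g_pos: "p \<ge> 2 \<Longrightarrow> ?g > 0"
    using step by (auto simp: segment_search_step_def)
  have model: "F ?z + blinfun_apply s (v - ?z) \<le> linearization f ?z v + real_of_ereal (\<psi> v)"
    if "v \<in> eff_dom \<psi>" for v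
    using cons(3)[OF that]
    by (simp add: F_def s_def linearization_def blinfun_linear_simps)
  have "F ?z + blinfun_apply s (x k - ?z) \<le> F (x k)"
    using model[OF x] linearization_le_convex[OF f, of ?z "x k"] diff by (simp add: F_def)
  then have at_x: "A k * (F ?z + blinfun_apply s (x k - ?z)) \<le> A k * F (x k)"
    using A by (rule mult_left_mono)
  have at_y: "?a * (F ?z + blinfun_apply s (y - ?z))
      \<le> ?a * (linearization f ?z y + real_of_ereal (\<psi> y))"
    using model[OF y] a_pos by (intro mult_left_mono) auto
  have growth: "estimating_real B f \<psi> x a k (\<upsilon> k) + 1 / 2 * (B_norm B (y - \<upsilon> k))\<^sup>2
      \<le> estimating_real B f \<psi> x a k y"
    by (rule estimating_real_quadratic_growth[OF B psi a \<upsilon> y min])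
  have "1 / 2 * (1 / H) powr (1 / real p) * ((A k + ?a) * ?g powr ((real p + 1) / real p))
      \<le> blinfun_apply s (A k *\<^sub>R x k + ?a *\<^sub>R y - (A k + ?a) *\<^sub>R ?z) + 1 / 2 * (B_norm B (y - \<upsilon> k))\<^sup>2"
    using step_gain[OF B p H A a_pos, where x = "x k" and x' = ?z and \<upsilon> = "\<upsilon> k" and \<tau> = "\<tau> k" and z = y]
      cons(4) a_eq g_pos
    unfolding s cons(2) by (simp add: w_def segment_residual_def direction_def)
  moreover have "blinfun_apply s (A k *\<^sub>R x k + ?a *\<^sub>R y - (A k + ?a) *\<^sub>R ?z)
      = A k * blinfun_apply s (x k - ?z) + ?a * blinfun_apply s (y - ?z)"
    by (simp add: blinfun_linear_simps algebra_simps)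
  moreover have "B_sum B p H f x \<upsilon> \<tau> A (Suc k) = B_sum B p H f x \<upsilon> \<tau> A k
      + 1 / 2 * (1 / H) powr (1 / real p) * ((A k + ?a) * ?g powr ((real p + 1) / real p))"
    by (simp add: B_sum_def A_Suc algebra_simps)
  moreover have "estimating_real B f \<psi> x a (Suc k) y = estimating_real B f \<psi> x a k y
      + ?a * (linearization f ?z y + real_of_ereal (\<psi> y))"
    by (simp add: estimating_real_def)
  ultimately show ?thesis
    using IH at_x at_y growth unfolding A_Suc F_def[symmetric] by (simp add: algebra_simps)
qed

lemma run_invariant:
  assumes B: "self_adjoint_pos_def B" and p: "p \<ge> 1" and H: "H > 0"
    and f: "convex_on UNIV f" and diff: "\<forall>y. f differentiable (at y)"
    and psi: "proper_closed_convex \<psi>"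
    and run: "segment_search_run B p H f \<psi> x0 N x \<upsilon> \<tau> a A"
    and k: "enat k \<le> N"
  shows "x k \<in> eff_dom \<psi> \<and> A k = (\<Sum>i<k. a (Suc i)) \<and> (\<forall>i<k. a (Suc i) > 0) \<and>
    \<upsilon> k \<in> eff_dom \<psi> \<and>
    (\<forall>y\<in>eff_dom \<psi>. estimating_real B f \<psi> x a k (\<upsilon> k) \<le> estimating_real B f \<psi> x a k y) \<and>
    (\<forall>y\<in>eff_dom \<psi>. A k * (f (x k) + real_of_ereal (\<psi> (x k))) + B_sum B p H f x \<upsilon> \<tau> A k
      \<le> estimating_real B f \<psi> x a k y)"
  using k
proof (induction k)
  case 0
  have "B_norm B 0 = 0" by (simp add: B_norm_def)
  then show ?case using run by (simp add: segment_search_run_def estimating_real_def B_sum_def)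
next
  case (Suc k)
  then have k: "enat k < N" by (metis Suc_ile_eq)
  with run have step: "segment_search_step B p H f \<psi> x \<upsilon> \<tau> a A k"
    by (simp add: segment_search_run_def)
  note IH = Suc.IH[OF less_imp_le[OF k]]
  note cons = segment_search_step_consequences[OF B p H diff psi step]
  have a: "\<forall>i<Suc k. a (Suc i) > 0"
    using IH step by (auto simp: segment_search_step_def less_Suc_eq)
  have "A (Suc k) = (\<Sum>i<Suc k. a (Suc i))"
    using IH step by (simp add: segment_search_step_def)
  moreover have "A k = (\<Sum>i<k. a (Suc i))" using IH by blast
  then have "A k \<ge> 0" using a by (auto intro!: sum_nonneg intro: less_imp_le)
  then have "A (Suc k) * (f (x (Suc k)) + real_of_ereal (\<psi> (x (Suc k)))) + B_sum B p H f x \<upsilon> \<tau> A (Suc k)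
      \<le> estimating_real B f \<psi> x a (Suc k) y" if "y \<in> eff_dom \<psi>" for y
    using IH that by (intro estimating_sequence_step[OF B p H f diff psi step]) (auto intro: less_imp_le)
  ultimately show ?case using cons(1,5,6) a by blast
qed

theorem theorem5:
  fixes B :: "'a::real_normed_vector \<Rightarrow>\<^sub>L 'a \<Rightarrow>\<^sub>L real"
    and f :: "'a \<Rightarrow> real"
    and \<psi> :: "'a \<Rightarrow> ereal"
    and p :: nat
    and H :: real
    and x0 x_star :: 'a
    and N :: enat
    and x \<upsilon> :: "nat \<Rightarrow> 'a"
    and \<tau> a A :: "nat \<Rightarrow> real"
  assumes finite_dim: "\<exists>S::'a set. finite S \<and> span S = UNIV"
    and B: "self_adjoint_pos_def B"
    and p: "p \<ge> 1"
    and H: "H > 0"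
    and f_convex: "convex_on UNIV f"
    and f_diff: "\<forall>y. f differentiable (at y)"
    and psi: "proper_closed_convex \<psi>"
    and psi_subdiff: "\<forall>y\<in>eff_dom \<psi>. subdifferential \<psi> y \<noteq> {}"
    and x_star: "x_star \<in> eff_dom \<psi>" "\<forall>y. composite f \<psi> x_star \<le> composite f \<psi> y"
    and run: "segment_search_run B p H f \<psi> x0 N x \<upsilon> \<tau> a A"
  shows "\<forall>k\<ge>1. enat k \<le> N \<longrightarrow>
      (\<forall>y\<in>eff_dom \<psi>. estimating B f \<psi> x a k y
          \<le> ereal (A k) * composite f \<psi> y + ereal (1 / 2 * (B_norm B (y - x0))\<^sup>2)) \<and>
      ereal (A k) * composite f \<psi> (x k) + ereal (B_sum B p H f x \<upsilon> \<tau> A k)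
          \<le> estimating_min B f \<psi> x a k \<and>
      composite f \<psi> (x k) - composite f \<psi> x_star
          \<le> ereal (2 ^ p * H * B_norm B (x0 - x_star) ^ (p + 1)
              * (1 + 2 * (real k - 1) / (real p + 1)) powr (- (3 * real p + 1) / 2))"
proof (intro allI impI)
  fix k :: nat
  assume k1: "k \<ge> 1" and kN: "enat k \<le> N"
  define F where "F y = f y + real_of_ereal (\<psi> y)" for y
  define R where "R = B_norm B (x0 - x_star)"
  define rate where "rate = 2 ^ p * H * R ^ (p + 1)
      * (1 + 2 * (real k - 1) / (real p + 1)) powr (- (3 * real p + 1) / 2)"
  have F: "composite f \<psi> y = ereal (F y)" if y: "y \<in> eff_dom \<psi>" for y
    unfolding composite_def by (subst eff_dom_real[OF psi y]) (simp add: F_def)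
  note est = estimating_eq_real[OF psi]
  have xk: "x k \<in> eff_dom \<psi>" and A_sum: "A k = (\<Sum>i<k. a (Suc i))"
    and a: "\<And>i. i < k \<Longrightarrow> a (Suc i) > 0"
    and lower: "\<And>y. y \<in> eff_dom \<psi> \<Longrightarrow>
      A k * F (x k) + B_sum B p H f x \<upsilon> \<tau> A k \<le> estimating_real B f \<psi> x a k y"
    using run_invariant[OF B p H f_convex f_diff psi run kN] by (auto simp: F_def)
  have A_pos: "A k > 0"
    unfolding A_sum using a k1 by (intro sum_pos) (auto simp: lessThan_empty_iff)
  have x0: "x 0 = x0" "A 0 = 0" using run by (auto simp: segment_search_run_def)
  have upper: "estimating_real B f \<psi> x a k y \<le> A k * F y + 1 / 2 * (B_norm B (y - x0))\<^sup>2" for y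
    using estimating_real_le[OF f_convex f_diff, of k a B \<psi> x y] a
    by (simp add: A_sum F_def x0 less_imp_le)
  have step: "segment_search_step B p H f \<psi> x \<upsilon> \<tau> a A i" if "i < k" for i
  proof -
    have "enat i < N" using that kN by (meson enat_ord_simps(2) less_le_trans)
    then show ?thesis using run by (simp add: segment_search_run_def)
  qed

  have "B_norm B (x_star - x0) = R" using B_norm_minus[of B "x0 - x_star"] by (simp add: R_def)
  then have gap: "A k * (F (x k) - F x_star) + B_sum B p H f x \<upsilon> \<tau> A k \<le> 1 / 2 * R\<^sup>2"
    using lower[OF x_star(1)] upper[of x_star] by (simp add: algebra_simps)
  have opt: "F x_star \<le> F (x k)"
    using x_star(2)[rule_format, of "x k"] by (simp add: F xk x_star(1))
  define \<Sigma> where "\<Sigma> = (\<Sum>i<k. A (Suc i) * grad_size B p H f x \<upsilon> \<tau> i powr ((real p + 1) / real p))"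
  have B_sum: "B_sum B p H f x \<upsilon> \<tau> A k = 1 / 2 * ((1 / H) powr (1 / real p) * \<Sigma>)"
    by (simp add: B_sum_def \<Sigma>_def)
  have A_nonneg: "A (Suc i) \<ge> 0" if "i < k" for i
  proof -
    have "enat (Suc i) \<le> N"
      using that kN by (meson Suc_leI enat_ord_simps(1) order_trans)
    from run_invariant[OF B p H f_convex f_diff psi run this]
    have "A (Suc i) = (\<Sum>j<Suc i. a (Suc j))" by blast
    also have "\<dots> \<ge> 0" using a that by (intro sum_nonneg) (auto intro: less_imp_le)
    finally show ?thesis .
  qed
  have "\<Sigma> \<ge> 0" unfolding \<Sigma>_def using A_nonneg by (intro sum_nonneg) auto
  then have B_nonneg: "B_sum B p H f x \<upsilon> \<tau> A k \<ge> 0" by (simp add: B_sum)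
  have "0 \<le> A k * (F (x k) - F x_star)" using A_pos opt by simp
  then have "(1 / H) powr (1 / real p) * \<Sigma> \<le> R\<^sup>2" using gap B_sum by simp
  then have budget: "\<Sigma> \<le> H powr (1 / real p) * R\<^sup>2"
    using H by (simp add: powr_divide field_simps)
  have "R\<^sup>2 \<le> 2 * A k * rate"
    unfolding rate_def
  proof (rule weight_lower_bound[where A = A and a = a and g = "grad_size B p H f x \<upsilon> \<tau>", OF p H _ k1 x0(2)])
    show "R \<ge> 0" unfolding R_def by (rule B_norm_nonneg[OF B])
  qed (use budget step in \<open>auto simp: \<Sigma>_def segment_search_step_def\<close>)
  with gap B_nonneg have "A k * (F (x k) - F x_star) \<le> A k * rate" by simp
  then have rate: "F (x k) - F x_star \<le> rate" using A_pos by simp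

  show "(\<forall>y\<in>eff_dom \<psi>. estimating B f \<psi> x a k y
          \<le> ereal (A k) * composite f \<psi> y + ereal (1 / 2 * (B_norm B (y - x0))\<^sup>2)) \<and>
      ereal (A k) * composite f \<psi> (x k) + ereal (B_sum B p H f x \<upsilon> \<tau> A k)
          \<le> estimating_min B f \<psi> x a k \<and>
      composite f \<psi> (x k) - composite f \<psi> x_star
          \<le> ereal (2 ^ p * H * B_norm B (x0 - x_star) ^ (p + 1)
              * (1 + 2 * (real k - 1) / (real p + 1)) powr (- (3 * real p + 1) / 2))"
  proof (intro conjI ballI)
    fix y assume y: "y \<in> eff_dom \<psi>"
    show "estimating B f \<psi> x a k y
        \<le> ereal (A k) * composite f \<psi> y + ereal (1 / 2 * (B_norm B (y - x0))\<^sup>2)"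
      using upper[of y] by (simp add: est[OF y] F[OF y])
  next
    show "ereal (A k) * composite f \<psi> (x k) + ereal (B_sum B p H f x \<upsilon> \<tau> A k)
        \<le> estimating_min B f \<psi> x a k"
      unfolding estimating_min_def
      by (intro INF_greatest) (use lower in \<open>simp add: est F[OF xk]\<close>)
  next
    show "composite f \<psi> (x k) - composite f \<psi> x_star
        \<le> ereal (2 ^ p * H * B_norm B (x0 - x_star) ^ (p + 1)
            * (1 + 2 * (real k - 1) / (real p + 1)) powr (- (3 * real p + 1) / 2))"
      using rate by (simp add: F[OF xk] F[OF x_star(1)] rate_def R_def)
  qed
qed

end
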